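(* Let $(F,v)$ be a valued field of equicharacteristic, with value group $\Gamma$. Let $q$ be a prime number and assume that $t\in F$ is such that $q\Gamma,\ q\Gamma+v(t),\ \ldots,\ q\Gamma+(q-1)v(t)$ are distinct cosets in $\Gamma$. Assume that $F$ contains all primitive $q$-th roots of $1$ (and that such roots exist, i.e. $\mathrm{char}(F)\neq q$). In particular, $K=F(u)$, where $u^q=t$, is a proper cyclic extension of $F$ of degree $q$. Let $Fv$ be the residue field and let $\mathrm{res}$ be the residue map extended to $F$. Then $$\mathrm{res}(N_{K/F}(K))\setminus\{0\}=(Fv)^{\times q}.$$
   Context: A valued field $(F,v)$ has a value group $\Gamma=v(F^\times)$ (an ordered abelian group, written additively), valuation ring $\mathcal{O}_v$ and residue field $Fv$. It is of equicharacteristic if $F$ and $Fv$ have the same characteristic. The residue map $\mathrm{res}:\mathcal{O}_v\to Fv$ is extended to all of $F$ by sending every element of $F\setminus\mathcal{O}_v$ to $0$. For a field $k$, $k^{\times q}$ denotes the subgroup of $q$-th powers in $k^\times$. For a cyclic (Galois) extension $K/F$, $N_{K/F}:K\to F$ is the norm, $N_{K/F}(a)=\prod_{\sigma\in\mathrm{Gal}(K/F)}\sigma(a)$. *)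

theory Defs
  imports "HOL-Algebra.Algebra" "HOL-Computational_Algebra.Primes"
begin

section \<open>Groups and rings\<close>

text \<open>For a multiplicative group this is the set of \<open>n\<close>-th powers; for an ordered group
  written additively (see \<open>value_group\<close> below) it is the set of \<open>n\<close>-fold multiples.\<close>

definition nth_powers :: "('a, 'b) monoid_scheme \<Rightarrow> nat \<Rightarrow> 'a set"
  where "nth_powers G n = (\<lambda>x. x [^]\<^bsub>G\<^esub> n) ` carrier G"

text \<open>\<open>group.ord\<close> is \<open>0\<close> on elements of infinite order, as required for characteristic \<open>0\<close>.\<close>

definition ring_characteristic :: "('a, 'b) ring_scheme \<Rightarrow> nat"
  where "ring_characteristic R = group.ord (add_monoid R) \<one>\<^bsub>R\<^esub>"

definition primitive_roots :: "('a, 'b) ring_scheme \<Rightarrow> nat \<Rightarrow> 'a set"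
  where "primitive_roots R n =
    {z \<in> carrier R. z [^]\<^bsub>R\<^esub> n = \<one>\<^bsub>R\<^esub> \<and> (\<forall>m. 0 < m \<and> m < n \<longrightarrow> z [^]\<^bsub>R\<^esub> m \<noteq> \<one>\<^bsub>R\<^esub>)}"

section \<open>Valued fields\<close>

text \<open>Only the values of \<open>v\<close> on nonzero elements matter: instead of \<open>v 0 = \<infinity>\<close>, the zero
  element is treated separately everywhere. The map \<open>v\<close> need not be onto \<open>'g\<close>; the value
  group is its image on nonzero elements.\<close>

locale valued_field = field F for F :: "('a, 'b) ring_scheme" (structure) +
  fixes v :: "'a \<Rightarrow> 'g::linordered_ab_group_add"
  assumes v_mult: "\<lbrakk>x \<in> carrier F - {\<zero>}; y \<in> carrier F - {\<zero>}\<rbrakk> \<Longrightarrow> v (x \<otimes> y) = v x + v y"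
    and v_add: "\<lbrakk>x \<in> carrier F - {\<zero>}; y \<in> carrier F - {\<zero>}; x \<oplus> y \<noteq> \<zero>\<rbrakk>
      \<Longrightarrow> min (v x) (v y) \<le> v (x \<oplus> y)"

text \<open>The operation of this monoid record is addition, so \<open>x [^] n\<close> means \<open>n\<close> times \<open>x\<close> and
  \<open>H #> x\<close> is the coset \<open>H + x\<close>.\<close>

definition value_group ::
    "('a, 'b) ring_scheme \<Rightarrow> ('a \<Rightarrow> 'g::linordered_ab_group_add) \<Rightarrow> 'g monoid"
  where "value_group F v =
    \<lparr>carrier = v ` (carrier F - {\<zero>\<^bsub>F\<^esub>}), monoid.mult = (+), one = 0\<rparr>"

definition valuation_ring ::
    "('a, 'b) ring_scheme \<Rightarrow> ('a \<Rightarrow> 'g::linordered_ab_group_add) \<Rightarrow> ('a, 'b) ring_scheme"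
  where "valuation_ring F v = F\<lparr>carrier := {x \<in> carrier F. x = \<zero>\<^bsub>F\<^esub> \<or> 0 \<le> v x}\<rparr>"

definition valuation_ideal ::
    "('a, 'b) ring_scheme \<Rightarrow> ('a \<Rightarrow> 'g::linordered_ab_group_add) \<Rightarrow> 'a set"
  where "valuation_ideal F v = {x \<in> carrier F. x = \<zero>\<^bsub>F\<^esub> \<or> 0 < v x}"

definition residue_field ::
    "('a, 'b) ring_scheme \<Rightarrow> ('a \<Rightarrow> 'g::linordered_ab_group_add) \<Rightarrow> 'a set ring"
  where "residue_field F v = valuation_ring F v Quot valuation_ideal F v"

definition residue_map ::
    "('a, 'b) ring_scheme \<Rightarrow> ('a \<Rightarrow> 'g::linordered_ab_group_add) \<Rightarrow> 'a \<Rightarrow> 'a set"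
  where "residue_map F v x =
    (if x \<in> carrier (valuation_ring F v)
     then valuation_ideal F v +>\<^bsub>valuation_ring F v\<^esub> x
     else \<zero>\<^bsub>residue_field F v\<^esub>)"

definition equicharacteristic ::
    "('a, 'b) ring_scheme \<Rightarrow> ('a \<Rightarrow> 'g::linordered_ab_group_add) \<Rightarrow> bool"
  where "equicharacteristic F v \<longleftrightarrow>
    ring_characteristic (residue_field F v) = ring_characteristic F"

section \<open>Field extensions\<close>

text \<open>The base field is a subset of the extension and carries the restricted operations.\<close>

definition field_extension :: "('a, 'b) ring_scheme \<Rightarrow> ('a, 'b) ring_scheme \<Rightarrow> bool"
  where "field_extension K F \<longleftrightarrow>
    field K \<and> subfield (carrier F) K \<and> F = K\<lparr>carrier := carrier F\<rparr>"

text \<open>Automorphisms are taken extensional (undefined off \<open>carrier K\<close>), so that each one is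
  represented by exactly one HOL function.\<close>

definition galois_group ::
    "('a, 'b) ring_scheme \<Rightarrow> ('a, 'b) ring_scheme \<Rightarrow> ('a \<Rightarrow> 'a) monoid"
  where "galois_group K F = BijGroup (carrier K)
    \<lparr>carrier := {\<sigma> \<in> ring_iso K K \<inter> extensional (carrier K). \<forall>a \<in> carrier F. \<sigma> a = a}\<rparr>"

definition galois_extension :: "('a, 'b) ring_scheme \<Rightarrow> ('a, 'b) ring_scheme \<Rightarrow> bool"
  where "galois_extension K F \<longleftrightarrow>
    field_extension K F \<and> ring.finite_dimension K (carrier F) (carrier K) \<and>
    {x \<in> carrier K. \<forall>\<sigma> \<in> carrier (galois_group K F). \<sigma> x = x} = carrier F"

definition cyclic_extension :: "('a, 'b) ring_scheme \<Rightarrow> ('a, 'b) ring_scheme \<Rightarrow> bool"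
  where "cyclic_extension K F \<longleftrightarrow> galois_extension K F \<and> cyclic_group (galois_group K F)"

definition field_norm ::
    "('a, 'b) ring_scheme \<Rightarrow> ('a, 'b) ring_scheme \<Rightarrow> 'a \<Rightarrow> 'a"
  where "field_norm K F a = (\<Otimes>\<^bsub>K\<^esub>\<sigma> \<in> carrier (galois_group K F). \<sigma> a)"

end

theory Submission
  imports Defs
begin

text \<open>Write \<open>w\<close> for the extension of \<open>v\<close> to \<open>K\<close>. The values \<open>w (c u\<^sup>i) = v c + i v(t) / q\<close>
  of monomials with \<open>i < q\<close> are pairwise distinct, so every nonzero element of \<open>K\<close> is a monomial
  times a one-unit \<open>1 + m\<close> with \<open>w m > 0\<close>. The one-units are stable under multiplication and under
  the Galois group, so a norm is \<open>N(c u\<^sup>i) (1 + f)\<close> with \<open>v f > 0\<close>. If it has value zero, then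
  \<open>q v c + i v t = 0\<close>, which forces \<open>i = 0\<close> and \<open>v c = 0\<close>; the residue is then the \<open>q\<close>-th power
  of the residue of \<open>c\<close>. To avoid division in the value group, the proof works with
  \<open>q w (c u\<^sup>i) = v (c\<^sup>q t\<^sup>i)\<close>.\<close>

section \<open>Valued fields and residues\<close>

text \<open>The extension \<open>w\<close> is never constructed. Existence and uniqueness of
  extensions of valuations are replaced by computation with monomials: \<open>mval c i\<close>
  stands for \<open>q w (c u^i)\<close>, and \<open>higher g\<close> for the set where
  \<open>q w > g\<close>, described as the sums of monomials of larger value. Invariance under the
  Galois group then needs no uniqueness of \<open>w\<close>: a conjugation multiplies each monomial
  by a root of unity, whose value is zero. The price is that membership in \<open>higher g\<close>
  must be translated back into a statement about \<open>v\<close> on the base field, which works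
  because coordinates with respect to the powers of \<open>u\<close> are unique. This in turn
  requires that \<open>u\<close> have degree exactly \<open>q\<close>, and that is also derived from
  the distinctness of values: a proper factor of \<open>X^q - t\<close> would contradict it. The
  inclusion of the \<open>q\<close>-th powers in the residues of norms is the easy half, since an
  element \<open>c\<close> of the base field has norm \<open>c^q\<close>.\<close>

context valued_field
begin

lemma v_one: "v \<one> = 0"
  using v_mult[of \<one> \<one>] by simp

lemma v_inv:
  assumes "x \<in> carrier F - {\<zero>}"
  shows "inv x \<in> carrier F - {\<zero>}" "v (inv x) = - v x"
proof -
  have x: "x \<in> Units F" using assms field_Units by simp
  then have "inv x \<in> Units F" by simp
  then show inv: "inv x \<in> carrier F - {\<zero>}" using field_Units by simp
  have "v x + v (inv x) = 0"
    using v_mult[OF assms inv] x v_one by simp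
  then show "v (inv x) = - v x"
    by (simp add: eq_neg_iff_add_eq_0 add.commute)
qed

lemma v_minus:
  assumes "x \<in> carrier F - {\<zero>}"
  shows "v (\<ominus> x) = v x"
proof -
  have m1: "\<ominus> \<one> \<in> carrier F - {\<zero>}"
    by auto
  then have "v (\<ominus> \<one>) + v (\<ominus> \<one>) = 0"
    using v_mult[of "\<ominus> \<one>" "\<ominus> \<one>"] v_one by (simp add: l_minus)
  then have "v (\<ominus> \<one>) = 0" by simp
  then show ?thesis
    using v_mult[OF m1 assms] assms by (simp add: l_minus)
qed

text \<open>The disjunction with \<open>x = \<zero>\<close> plays the role of
  \<open>v 0 = \<infinity>\<close>; in this form strict lower bounds pass to sums without any case
  distinction by the caller.\<close>

lemma v_add_greater:
  assumes "x \<in> carrier F" "y \<in> carrier F" "x = \<zero> \<or> c < v x" "y = \<zero> \<or> c < v y"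
  shows "x \<oplus> y = \<zero> \<or> c < v (x \<oplus> y)"
  proof (cases "x = \<zero> \<or> y = \<zero> \<or> x \<oplus> y = \<zero>")
  case True
  then show ?thesis using assms by auto
next
  case False
  then have "c < min (v x) (v y)" using assms by simp
  also have "\<dots> \<le> v (x \<oplus> y)" using False assms by (intro v_add) auto
  finally show ?thesis by simp
qed

text \<open>If the sum had a value above \<open>v x\<close>, then \<open>x\<close>, being the sum
  minus \<open>y\<close>, would have a value above its own.\<close>

lemma v_add_eq:
  assumes "x \<in> carrier F - {\<zero>}" "y \<in> carrier F" "y = \<zero> \<or> v x < v y"
  shows "x \<oplus> y \<noteq> \<zero>" "v (x \<oplus> y) = v x"
proof -
  have y: "\<ominus> y \<in> carrier F" "\<ominus> y = \<zero> \<or> v x < v (\<ominus> y)"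
    using assms v_minus[of y] by (cases "y = \<zero>"; auto)+
  show nz: "x \<oplus> y \<noteq> \<zero>"
  proof
    assume "x \<oplus> y = \<zero>"
    then have "x = \<ominus> y" using assms minus_equality by simp
    with y(2) assms(1) show False by auto
  qed
  have "x = (x \<oplus> y) \<oplus> \<ominus> y"
    using assms by (simp add: a_assoc r_neg)
  then have "\<not> v x < v (x \<oplus> y)"
    using v_add_greater[of "x \<oplus> y" "\<ominus> y" "v x"] y assms nz by auto
  moreover have "v x \<le> v (x \<oplus> y)"
    using v_add[of x y] assms nz by (cases "y = \<zero>") (auto simp: min_def split: if_splits)
  ultimately show "v (x \<oplus> y) = v x" by simp
qed

lemma pow_nonzero: "x \<in> carrier F - {\<zero>} \<Longrightarrow> x [^] (n::nat) \<in> carrier F - {\<zero>}"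
  by (induction n) (auto simp: integral_iff)

lemma v_pow_Suc: "x \<in> carrier F - {\<zero>} \<Longrightarrow> v (x [^] (n::nat) \<otimes> x) = v (x [^] n) + v x"
  using v_mult[OF pow_nonzero] by simp

lemma v_pow_pos: "\<lbrakk>x \<in> carrier F - {\<zero>}; n > (0::nat); v x > 0\<rbrakk> \<Longrightarrow> v (x [^] n) > 0"
proof (induction n)
  case (Suc n)
  then show ?case
    by (cases "n = 0") (auto simp: v_pow_Suc intro: add_pos_pos)
qed simp

lemma v_pow_neg: "\<lbrakk>x \<in> carrier F - {\<zero>}; n > (0::nat); v x < 0\<rbrakk> \<Longrightarrow> v (x [^] n) < 0"
proof (induction n)
  case (Suc n)
  then show ?case
    by (cases "n = 0") (auto simp: v_pow_Suc intro: add_neg_neg)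
qed simp

lemma v_pow_zero: "\<lbrakk>x \<in> carrier F - {\<zero>}; v x = 0\<rbrakk> \<Longrightarrow> v (x [^] (n::nat)) = 0"
  by (induction n) (auto simp: v_pow_Suc v_one)

lemma v_pow_pos_iff: "\<lbrakk>x \<in> carrier F - {\<zero>}; n > (0::nat)\<rbrakk> \<Longrightarrow> 0 < v (x [^] n) \<longleftrightarrow> 0 < v x"
  using v_pow_pos[of x n] v_pow_neg[of x n] v_pow_zero[of x n] by (metis less_asym less_irrefl linorder_less_linear)

section \<open>Valuation ring, residue map and the units of the residue field\<close>

lemma valuation_ring_subring: "subring (carrier (valuation_ring F v)) F"
proof (rule subringI)
  fix x y assume xy: "x \<in> carrier (valuation_ring F v)" "y \<in> carrier (valuation_ring F v)"
  then show "x \<otimes> y \<in> carrier (valuation_ring F v)"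
    using v_mult[of x y] by (cases "x = \<zero>"; cases "y = \<zero>") (auto simp: valuation_ring_def)
  show "x \<oplus> y \<in> carrier (valuation_ring F v)"
  proof (cases "x = \<zero> \<or> y = \<zero> \<or> x \<oplus> y = \<zero>")
    case True
    then show ?thesis using xy by (auto simp: valuation_ring_def)
  next
    case False
    then have "0 \<le> min (v x) (v y)" using xy by (simp add: valuation_ring_def)
    also have "\<dots> \<le> v (x \<oplus> y)" using False xy by (intro v_add) (auto simp: valuation_ring_def)
    finally show ?thesis using xy by (simp add: valuation_ring_def)
  qed
next
  fix x assume "x \<in> carrier (valuation_ring F v)"
  then show "\<ominus> x \<in> carrier (valuation_ring F v)"
    using v_minus[of x] by (cases "x = \<zero>") (auto simp: valuation_ring_def)
qed (auto simp: valuation_ring_def v_one)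

lemma valuation_ring_restrict: "valuation_ring F v = F\<lparr>carrier := carrier (valuation_ring F v)\<rparr>"
  by (simp add: valuation_ring_def)

lemma valuation_ring_domain: "domain (valuation_ring F v)"
  by (subst valuation_ring_restrict) (rule subring_is_domain[OF valuation_ring_subring])

lemma valuation_ring_simps:
  "x \<otimes>\<^bsub>valuation_ring F v\<^esub> y = x \<otimes> y" "x \<oplus>\<^bsub>valuation_ring F v\<^esub> y = x \<oplus> y"
  "\<one>\<^bsub>valuation_ring F v\<^esub> = \<one>" "\<zero>\<^bsub>valuation_ring F v\<^esub> = \<zero>"
  "x \<in> carrier (valuation_ring F v) \<longleftrightarrow> x \<in> carrier F \<and> (x = \<zero> \<or> 0 \<le> v x)"
  "x [^]\<^bsub>valuation_ring F v\<^esub> (n::nat) = x [^] n"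
  by (auto simp: valuation_ring_def nat_pow_def)

lemma valuation_ideal_ideal: "ideal (valuation_ideal F v) (valuation_ring F v)"
proof -
  interpret V: domain "valuation_ring F v" by (rule valuation_ring_domain)
  have mult: "x \<otimes> a \<in> valuation_ideal F v"
    if "a \<in> valuation_ideal F v" "x \<in> carrier (valuation_ring F v)" for a x
    using that v_mult[of x a]
    by (cases "a = \<zero>"; cases "x = \<zero>") (auto simp: valuation_ideal_def valuation_ring_simps intro: add_nonneg_pos)
  show ?thesis
  proof (rule idealI[OF V.ring_axioms])
    show "subgroup (valuation_ideal F v) (add_monoid (valuation_ring F v))"
    proof (rule V.add.subgroupI)
      show "valuation_ideal F v \<subseteq> carrier (valuation_ring F v)"
        by (auto simp: valuation_ideal_def valuation_ring_simps)
      show "valuation_ideal F v \<noteq> {}"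
        by (auto simp: valuation_ideal_def)
      fix a b assume a: "a \<in> valuation_ideal F v"
      \<comment> \<open>Negation is multiplication by minus one, so that closure under it becomes a
        case of \<open>mult\<close>.\<close>
      have "\<ominus>\<^bsub>valuation_ring F v\<^esub> a
          = \<ominus>\<^bsub>valuation_ring F v\<^esub> \<one>\<^bsub>valuation_ring F v\<^esub> \<otimes>\<^bsub>valuation_ring F v\<^esub> a"
      proof -
        have "a \<in> carrier (valuation_ring F v)"
          using a by (auto simp: valuation_ideal_def valuation_ring_simps(5))
        then show ?thesis by (simp add: V.l_minus)
      qed
      then show "\<ominus>\<^bsub>valuation_ring F v\<^esub> a \<in> valuation_ideal F v"
        using mult[OF a, of "\<ominus>\<^bsub>valuation_ring F v\<^esub> \<one>\<^bsub>valuation_ring F v\<^esub>"]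
          V.a_inv_closed[OF V.one_closed] valuation_ring_simps(1) by metis
      assume "b \<in> valuation_ideal F v"
      then show "a \<oplus>\<^bsub>valuation_ring F v\<^esub> b \<in> valuation_ideal F v"
        using a v_add_greater[of a b 0] by (auto simp: valuation_ideal_def valuation_ring_simps)
    qed
  qed (use mult V.m_comm in \<open>auto simp: valuation_ring_simps valuation_ideal_def m_comm\<close>)
qed

lemma residue_map_hom: "ring_hom_cring (valuation_ring F v) (residue_field F v) (residue_map F v)"
proof -
  interpret V: domain "valuation_ring F v" by (rule valuation_ring_domain)
  interpret I: ideal "valuation_ideal F v" "valuation_ring F v" by (rule valuation_ideal_ideal)
  have "residue_map F v \<in> ring_hom (valuation_ring F v) (residue_field F v)"
    using I.rcos_ring_hom unfolding residue_field_def
    by (intro ring_hom_memI) (auto simp: residue_map_def dest: ring_hom_memE)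
  then show ?thesis
    using I.quotient_is_cring[OF V.is_cring] V.is_cring
    by (intro ring_hom_cringI) (auto simp: residue_field_def)
qed

lemma residue_map_eq_zero_iff:
  assumes "x \<in> carrier (valuation_ring F v)"
  shows "residue_map F v x = \<zero>\<^bsub>residue_field F v\<^esub> \<longleftrightarrow> x \<in> valuation_ideal F v"
proof -
  interpret I: ideal "valuation_ideal F v" "valuation_ring F v" by (rule valuation_ideal_ideal)
  show ?thesis
    using assms I.a_rcos_const I.rcos_const_imp_mem[OF assms]
    by (auto simp: residue_map_def residue_field_def FactRing_def)
qed

lemma carrier_residue_field:
  "carrier (residue_field F v) = residue_map F v ` carrier (valuation_ring F v)"
  by (auto simp: residue_field_def FactRing_def A_RCOSETS_def' residue_map_def)

text \<open>Positive values die in the quotient and negative ones by the extension of the residue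
  map by zero. Removing zero from a set of residues therefore keeps exactly the residues of elements
  of value zero.\<close>

lemma residue_map_nonzero_iff:
  assumes "x \<in> carrier F"
  shows "residue_map F v x \<noteq> \<zero>\<^bsub>residue_field F v\<^esub> \<longleftrightarrow> x \<noteq> \<zero> \<and> v x = 0"
proof (cases "x \<in> carrier (valuation_ring F v)")
  case True
  then show ?thesis
    using assms by (auto simp: residue_map_eq_zero_iff valuation_ideal_def valuation_ring_simps)
next
  case False
  then show ?thesis
    using assms by (auto simp: residue_map_def valuation_ring_simps)
qed

text \<open>Lets the residue map be applied to all norms, as elements of \<open>K\<close>, without
  first showing that they lie in the base field.\<close>

lemma residue_map_outside: "x \<notin> carrier F \<Longrightarrow> residue_map F v x = \<zero>\<^bsub>residue_field F v\<^esub>"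
  by (simp add: residue_map_def valuation_ring_simps)

lemma Units_residue_field:
  "Units (residue_field F v) = residue_map F v ` {x \<in> carrier F - {\<zero>}. v x = 0}"
proof (intro equalityI subsetI)
  interpret h: ring_hom_cring "valuation_ring F v" "residue_field F v" "residue_map F v"
    by (rule residue_map_hom)
  have one: "\<one>\<^bsub>residue_field F v\<^esub> \<noteq> \<zero>\<^bsub>residue_field F v\<^esub>"
    using residue_map_nonzero_iff[OF one_closed] h.hom_one v_one by (simp add: valuation_ring_simps)
  {
    fix y assume y: "y \<in> Units (residue_field F v)"
    then have nz: "y \<noteq> \<zero>\<^bsub>residue_field F v\<^esub>"
      using one h.S.Units_r_inv[OF y] h.S.Units_inv_closed[OF y] h.S.l_null by metis
    obtain x where "x \<in> carrier (valuation_ring F v)" "y = residue_map F v x"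
      using h.S.Units_closed[OF y] unfolding carrier_residue_field by blast
    with nz show "y \<in> residue_map F v ` {x \<in> carrier F - {\<zero>}. v x = 0}"
      using residue_map_nonzero_iff[of x] by (auto simp: valuation_ring_simps)
  next
    fix y assume "y \<in> residue_map F v ` {x \<in> carrier F - {\<zero>}. v x = 0}"
    then obtain x where x: "x \<in> carrier F - {\<zero>}" "v x = 0" "y = residue_map F v x" by blast
    have mem: "x \<in> carrier (valuation_ring F v)" "inv x \<in> carrier (valuation_ring F v)"
      using x v_inv[OF x(1)] by (auto simp: valuation_ring_simps)
    have "x \<otimes> inv x = \<one>" using x field_Units by simp
    then have "y \<otimes>\<^bsub>residue_field F v\<^esub> residue_map F v (inv x) = \<one>\<^bsub>residue_field F v\<^esub>"
      using h.hom_mult[OF mem] h.hom_one x(3) by (simp add: valuation_ring_simps)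
    then show "y \<in> Units (residue_field F v)"
      using h.S.m_comm[OF h.hom_closed[OF mem(1)] h.hom_closed[OF mem(2)]]
        h.hom_closed[OF mem(1)] h.hom_closed[OF mem(2)] x(3)
      unfolding Units_def by auto
  }
qed

lemma residue_map_pow:
  assumes "x \<in> carrier (valuation_ring F v)"
  shows "residue_map F v (x [^] (n::nat)) = residue_map F v x [^]\<^bsub>residue_field F v\<^esub> n"
proof -
  interpret h: ring_hom_cring "valuation_ring F v" "residue_field F v" "residue_map F v"
    by (rule residue_map_hom)
  show ?thesis
    using h.ring.hom_nat_pow[OF assms, of n] by (simp add: valuation_ring_simps)
qed

text \<open>Isolates what has to be known about the set \<open>N\<close> of norms: it contains the
  \<open>n\<close>-th powers, and each of its members of value zero is an \<open>n\<close>-th power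
  up to a one-unit. One-units have residue one, so the residues are \<open>n\<close>-th powers
  too.\<close>

lemma residue_map_image_eq_nth_powers:
  assumes n: "n > 0"
    and powers: "\<And>c. c \<in> carrier F \<Longrightarrow> c [^] (n::nat) \<in> N"
    and units: "\<And>x. \<lbrakk>x \<in> N; x \<in> carrier F - {\<zero>}; v x = 0\<rbrakk> \<Longrightarrow>
      \<exists>c\<in>carrier F - {\<zero>}. \<exists>f\<in>valuation_ideal F v. v c = 0 \<and> x = c [^] n \<otimes> (\<one> \<oplus> f)"
  shows "residue_map F v ` N - {\<zero>\<^bsub>residue_field F v\<^esub>} = nth_powers (units_of (residue_field F v)) n"
proof -
  interpret h: ring_hom_cring "valuation_ring F v" "residue_field F v" "residue_map F v"
    by (rule residue_map_hom)
  let ?U = "{x \<in> carrier F - {\<zero>}. v x = 0}"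
  have U: "x \<in> carrier (valuation_ring F v)" if "x \<in> ?U" for x
    using that by (auto simp: valuation_ring_simps)
  have "nth_powers (units_of (residue_field F v)) n
      = (\<lambda>x. residue_map F v x [^]\<^bsub>residue_field F v\<^esub> n) ` ?U"
    by (simp add: nth_powers_def units_of_def nat_pow_def Units_residue_field image_image)
  also have "\<dots> = (\<lambda>x. residue_map F v (x [^] n)) ` ?U"
    using U residue_map_pow by (intro image_cong) auto
  also have "\<dots> = residue_map F v ` N - {\<zero>\<^bsub>residue_field F v\<^esub>}"
  proof (intro equalityI subsetI)
    fix y assume "y \<in> (\<lambda>x. residue_map F v (x [^] n)) ` ?U"
    then obtain c where c: "c \<in> ?U" "y = residue_map F v (c [^] n)" by blast
    then have "c [^] n \<in> carrier F - {\<zero>}" "v (c [^] n) = 0"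
      using pow_nonzero[of c n] v_pow_zero[of c n] by auto
    then have "y \<noteq> \<zero>\<^bsub>residue_field F v\<^esub>"
      using c residue_map_nonzero_iff by auto
    with c powers show "y \<in> residue_map F v ` N - {\<zero>\<^bsub>residue_field F v\<^esub>}" by auto
  next
    fix y assume "y \<in> residue_map F v ` N - {\<zero>\<^bsub>residue_field F v\<^esub>}"
    then obtain x where x: "x \<in> N" "y = residue_map F v x" "y \<noteq> \<zero>\<^bsub>residue_field F v\<^esub>" by auto
    then have "x \<in> carrier F - {\<zero>}" "v x = 0"
      using residue_map_outside[of x] residue_map_nonzero_iff[of x] by auto
    with units x(1) obtain c f where c: "c \<in> carrier F - {\<zero>}" "v c = 0"
      and f: "f \<in> valuation_ideal F v" and eq: "x = c [^] n \<otimes> (\<one> \<oplus> f)"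
      by blast
    have cU: "c [^] n \<in> carrier (valuation_ring F v)"
      using c pow_nonzero[of c n] v_pow_zero[of c n] by (auto simp: valuation_ring_simps)
    have fO: "f \<in> carrier (valuation_ring F v)"
      using f by (auto simp: valuation_ideal_def valuation_ring_simps)
    have one: "residue_map F v \<one> = \<one>\<^bsub>residue_field F v\<^esub>"
      using h.hom_one by (simp add: valuation_ring_simps)
    have "residue_map F v (\<one> \<oplus> f) = \<one>\<^bsub>residue_field F v\<^esub>"
      using h.hom_add[OF h.R.one_closed fO] residue_map_eq_zero_iff[OF fO] f one
      by (simp add: valuation_ring_simps)
    moreover have "\<one> \<oplus> f \<in> carrier (valuation_ring F v)"
      using h.R.a_closed[OF h.R.one_closed fO] by (simp add: valuation_ring_simps)
    ultimately have "y = residue_map F v (c [^] n)"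
      using h.hom_mult[OF cU, of "\<one> \<oplus> f"] h.hom_closed[OF cU] x(2) eq
      by (simp add: valuation_ring_simps)
    with c show "y \<in> (\<lambda>x. residue_map F v (x [^] n)) ` ?U" by blast
  qed
  finally show ?thesis by simp
qed

end

text \<open>If \<open>v (c\<^sup>q t\<^sup>i) = v (d\<^sup>q t\<^sup>j)\<close>, then \<open>i v t\<close> and \<open>j v t\<close> differ by
  \<open>q (v d - v c)\<close>, so their cosets coincide.\<close>

lemma (in valued_field) separated_if_cosets_distinct:
  assumes t: "t \<in> carrier F - {\<zero>}"
    and inj: "inj_on (\<lambda>i::nat. nth_powers (value_group F v) q
      #>\<^bsub>value_group F v\<^esub> (v t [^]\<^bsub>value_group F v\<^esub> i)) {..<q}"
    and cd: "c \<in> carrier F - {\<zero>}" "d \<in> carrier F - {\<zero>}" and ij: "i < q" "j < q"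
    and eq: "v (c [^] q \<otimes> t [^] i) = v (d [^] q \<otimes> t [^] j)"
  shows "i = j"
proof -
  let ?G = "value_group F v"
  have pow: "v x [^]\<^bsub>?G\<^esub> n = v (x [^] n)" if "x \<in> carrier F - {\<zero>}" for x and n :: nat
    by (induction n) (use v_pow_Suc[OF that] v_one in \<open>simp_all add: value_group_def\<close>)
  have coset: "nth_powers ?G q #>\<^bsub>?G\<^esub> (v t [^]\<^bsub>?G\<^esub> i) = {v (x [^] q \<otimes> t [^] i) | x. x \<in> carrier F - {\<zero>}}" for i :: nat
  proof -
    have "nth_powers ?G q = (\<lambda>x. v (x [^] q)) ` (carrier F - {\<zero>})"
      unfolding nth_powers_def using pow by (auto simp: value_group_def image_image)
    moreover have "v (x [^] q) \<otimes>\<^bsub>?G\<^esub> v (t [^] i) = v (x [^] q \<otimes> t [^] i)" if "x \<in> carrier F - {\<zero>}" for x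
      using v_mult[OF pow_nonzero[OF that] pow_nonzero[OF t]] by (simp add: value_group_def)
    ultimately show ?thesis
      by (auto simp: r_coset_def pow[OF t])
  qed
  \<comment> \<open>General in \<open>c\<close>, \<open>d\<close>, \<open>i\<close> and
    \<open>j\<close>, so that exchanging the two sides gives the reverse inclusion.\<close>
  have sub: "{v (x [^] q \<otimes> t [^] i) | x. x \<in> carrier F - {\<zero>}} \<subseteq> {v (x [^] q \<otimes> t [^] j) | x. x \<in> carrier F - {\<zero>}}"
    if cd: "c \<in> carrier F - {\<zero>}" "d \<in> carrier F - {\<zero>}" and eq: "v (c [^] q \<otimes> t [^] i) = v (d [^] q \<otimes> t [^] j)"
    for c d and i j :: nat
  proof (intro subsetI)
    fix y assume "y \<in> {v (x [^] q \<otimes> t [^] i) | x. x \<in> carrier F - {\<zero>}}"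
    then obtain x where x: "x \<in> carrier F - {\<zero>}" "y = v (x [^] q \<otimes> t [^] i)" by blast
    \<comment> \<open>The factor \<open>d / c\<close> compensates for the change from
      \<open>t^i\<close> to \<open>t^j\<close>, because \<open>c^q t^i\<close> and
      \<open>d^q t^j\<close> have the same value.\<close>
    define w where "w = x \<otimes> inv c \<otimes> d"
    have inv: "inv c \<in> carrier F - {\<zero>}" by (rule v_inv(1)[OF cd(1)])
    then have w: "w \<in> carrier F - {\<zero>}" using x cd by (auto simp: w_def integral_iff)
    have "w \<otimes> c = x \<otimes> d"
    proof -
      have "w \<otimes> c = (x \<otimes> d) \<otimes> (inv c \<otimes> c)"
        unfolding w_def using x cd inv by (simp add: m_ac)
      then show ?thesis using x cd field_Units by simp
    qed
    then have "w [^] q \<otimes> c [^] q = x [^] q \<otimes> d [^] q"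
      using w x cd by (metis DiffD1 nat_pow_distrib)
    then have "v (w [^] q) + v (c [^] q) = v (x [^] q) + v (d [^] q)"
      using v_mult pow_nonzero w x cd by metis
    moreover have "v (c [^] q) + v (t [^] i) = v (d [^] q) + v (t [^] j)"
      using eq v_mult pow_nonzero t cd by metis
    ultimately have "(v (w [^] q) + v (c [^] q)) + (v (d [^] q) + v (t [^] j))
        = (v (x [^] q) + v (d [^] q)) + (v (c [^] q) + v (t [^] i))"
      by simp
    then have "v (w [^] q) + v (t [^] j) = v (x [^] q) + v (t [^] i)"
      by (simp add: ac_simps)
    then have "y = v (w [^] q \<otimes> t [^] j)"
      using x v_mult[OF pow_nonzero pow_nonzero[OF t]] w by simp
    with w show "y \<in> {v (x [^] q \<otimes> t [^] j) | x. x \<in> carrier F - {\<zero>}}" by blast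
  qed
  have "nth_powers ?G q #>\<^bsub>?G\<^esub> (v t [^]\<^bsub>?G\<^esub> i) = nth_powers ?G q #>\<^bsub>?G\<^esub> (v t [^]\<^bsub>?G\<^esub> j)"
    unfolding coset using sub[OF cd eq] sub[OF cd(2,1) eq[symmetric]] by blast
  then show ?thesis
    using inj_onD[OF inj] ij by simp
qed

section \<open>Radical and Kummer extensions\<close>

text \<open>Lists begin with the leading coefficient while \<open>coeff\<close> is indexed by
  degree. Leading zeros are allowed, so the formula also serves for lists that are not
  normalized.\<close>

lemma (in ring) eval_eq_finsum:
  assumes "set p \<subseteq> carrier R" "x \<in> carrier R"
  shows "eval p x = (\<Oplus>i\<in>{..<length p}. coeff p i \<otimes> x [^] i)"
  using assms(1)
proof (induction p)
  case Nil
  then show ?case by simp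
next
  case (Cons a p)
  then have a: "a \<in> carrier R" and p: "set p \<subseteq> carrier R" by auto
  have "(\<Oplus>i\<in>{..<length p}. coeff (a # p) i \<otimes> x [^] i)
      = (\<Oplus>i\<in>{..<length p}. coeff p i \<otimes> x [^] i)"
    using p assms(2) by (intro finsum_cong') auto
  moreover have "(\<Oplus>i\<in>insert (length p) {..<length p}. coeff (a # p) i \<otimes> x [^] i)
      = coeff (a # p) (length p) \<otimes> x [^] length p \<oplus> (\<Oplus>i\<in>{..<length p}. coeff (a # p) i \<otimes> x [^] i)"
    using a p assms(2) by (intro finsum_insert) auto
  ultimately show ?case
    using Cons.IH[OF p] by (simp add: lessThan_Suc)
qed

text \<open>For positive \<open>n\<close> this is the polynomial \<open>X^n - c\<close>, leading
  coefficient first.\<close>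

definition (in ring) binom_poly :: "nat \<Rightarrow> 'a \<Rightarrow> 'a list"
  where "binom_poly n c = \<one> # replicate (n - 1) \<zero> @ [\<ominus> c]"

lemma (in ring) length_binom_poly: "n > 0 \<Longrightarrow> length (binom_poly n c) = Suc n"
  by (simp add: binom_poly_def)

lemma (in domain) binom_poly_closed:
  assumes "subring A R" "c \<in> A"
  shows "binom_poly n c \<in> carrier (A[X])"
  using subringE[OF assms(1)] assms(2)
  by (auto simp: binom_poly_def univ_poly_def polynomial_def)

lemma (in ring) eval_binom_poly:
  assumes "n > 0" "c \<in> carrier R" "x \<in> carrier R"
  shows "eval (binom_poly n c) x = x [^] n \<ominus> c"
proof -
  have "eval (replicate (n - 1) \<zero> @ [\<ominus> c]) x = \<ominus> c"
    using assms eval_replicate[of "[\<ominus> c]" x "n - 1"] by simp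
  then show ?thesis
    using assms by (simp add: binom_poly_def minus_eq)
qed

lemma (in ring) coeff_binom_poly:
  assumes "n > 0"
  shows "coeff (binom_poly n c) i = (if i = n then \<one> else if i = 0 then \<ominus> c else \<zero>)"
proof -
  have "coeff (replicate (n - 1) \<zero> @ [\<ominus> c]) i = (if i = 0 then \<ominus> c else \<zero>)"
    using prefix_replicate_zero_coeff[of "[\<ominus> c]" "n - 1"] by (metis coeff.simps(1,2) length_0_conv length_tl list.sel(1,3) list.size(3))
  then show ?thesis
    using assms by (auto simp: binom_poly_def)
qed

section \<open>Powers of a radical as coordinates over the base field\<close>

locale radical_extension = field K for K :: "('a, 'b) ring_scheme" (structure) +
  fixes A :: "'a set" and q :: nat and t u :: 'a
  assumes base: "subfield A K"
    and prime_q: "Factorial_Ring.prime q"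
    and t_in: "t \<in> A" and t_nonzero: "t \<noteq> \<zero>"
    and u_closed: "u \<in> carrier K" and u_pow: "u [^] q = t"
    and generated: "carrier K = generate_field K (insert u A)"
begin

lemma q_pos: "q > 0"
  using prime_q by (simp add: prime_gt_0_nat)

lemma base_subring: "subring A K"
  by (rule subfieldE(1)[OF base])

lemmas base_closed = subringE(2,3,5-7)[OF base_subring]

lemma base_in_carrier: "x \<in> A \<Longrightarrow> x \<in> carrier K"
  using subringE(1)[OF base_subring] by blast

lemma base_pow: "x \<in> A \<Longrightarrow> x [^] (n::nat) \<in> A"
  by (induction n) (auto simp: base_closed)

lemma u_nonzero: "u \<noteq> \<zero>"
  using u_pow t_nonzero q_pos by (metis nat_pow_zero neq0_conv)

lemma eval_binom_u: "eval (binom_poly q t) u = \<zero>"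
  using eval_binom_poly[OF q_pos base_in_carrier[OF t_in] u_closed] u_pow base_in_carrier[OF t_in]
  by simp

lemma algebraic_u: "(algebraic over A) u"
  by (rule algebraicI[OF binom_poly_closed[OF base_subring t_in] _ eval_binom_u])
    (simp add: binom_poly_def)

lemma simple_extension_eq: "simple_extension A u = carrier K"
proof
  show "simple_extension A u \<subseteq> carrier K"
    using simple_extension_in_carrier u_closed base_in_carrier by blast
  have "subfield (simple_extension A u) K"
    using simple_extension_is_subfield[OF base u_closed] algebraic_u by simp
  moreover have "insert u A \<subseteq> simple_extension A u"
    using simple_extension_mem[OF base_subring u_closed]
      simple_extension_incl[of A u] base_in_carrier u_closed by blast
  ultimately show "carrier K \<subseteq> simple_extension A u"
    using generate_field_min_subfield1[of "insert u A"] base_in_carrier u_closed generated by blast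
qed

lemma dimension_degree: "dimension (degree (Irr A u)) A (carrier K)"
  using dimension_simple_extension[OF base u_closed algebraic_u] by (simp add: simple_extension_eq)

lemma Irr_dvd:
  assumes "p \<in> carrier (A[X])" "eval p u = \<zero>"
  obtains h where "h \<in> carrier (A[X])" "p = poly_mult (Irr A u) h"
  using Irr_minimal[OF base u_closed algebraic_u assms]
    pdivides_iff_shell[OF base IrrE(1)[OF base u_closed algebraic_u] assms(1)]
  by (auto simp: factor_def univ_poly_mult)

text \<open>A nonzero list is one longer than its degree, so the length bound says that the degree
  is strictly below that of the minimal polynomial, which divides \<open>p\<close>.\<close>

lemma poly_eq_NilI:
  assumes "p \<in> carrier (A[X])" "eval p u = \<zero>" "length p \<le> degree (Irr A u)"
  shows "p = []"
proof (rule ccontr)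
  assume "p \<noteq> []"
  then have "degree (Irr A u) \<le> degree p"
    using pdivides_imp_degree_le[OF base_subring IrrE(1)[OF base u_closed algebraic_u] assms(1)]
      Irr_minimal[OF base u_closed algebraic_u assms(1,2)] by blast
  with assms(3) \<open>p \<noteq> []\<close> show False
    by (cases p) auto
qed

lemma powers_independent:
  assumes a: "\<And>i. i < n \<Longrightarrow> a i \<in> A" and sum: "(\<Oplus>i\<in>{..<n}. a i \<otimes> u [^] i) = \<zero>"
    and n: "n \<le> degree (Irr A u)" and i: "i < n"
  shows "a i = \<zero>"
proof -
  \<comment> \<open>The leading coefficient comes first, hence \<open>rev\<close>. It may be zero,
    so only \<open>normalize p\<close> is an element of \<open>A[X]\<close>.\<close>
  define p where "p = map a (rev [0..<n])"
  have p: "set p \<subseteq> A" "set p \<subseteq> carrier K" "length p = n"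
    using a base_in_carrier by (auto simp: p_def)
  have c: "coeff p j = a j" if "j < n" for j
    using that coeff_nth[of j p] by (simp add: p_def rev_nth rev_map[symmetric] flip: map_map)
  have "eval p u = (\<Oplus>i\<in>{..<n}. a i \<otimes> u [^] i)"
    unfolding eval_eq_finsum[OF p(2) u_closed] p(3)
    by (rule finsum_cong') (use a base_in_carrier u_closed c in auto)
  then have "eval (normalize p) u = \<zero>"
    using sum eval_normalize[OF p(2) u_closed] by simp
  moreover have "normalize p \<in> carrier (A[X])"
    using normalize_gives_polynomial[OF p(1)] by (simp add: univ_poly_carrier)
  moreover have "length (normalize p) \<le> degree (Irr A u)"
    using normalize_length_le[of p] p(3) n by simp
  ultimately have "normalize p = []"
    by (intro poly_eq_NilI)
  then have "coeff p i = \<zero>"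
    using normalize_coeff[of p] by simp
  then show ?thesis
    using c i by simp
qed

lemma powers_span:
  assumes "x \<in> carrier K"
  obtains a where "range a \<subseteq> A" "x = (\<Oplus>i\<in>{..<degree (Irr A u)}. a i \<otimes> u [^] i)"
proof -
  have "x \<in> Span A (exp_base u (degree (Irr A u)))"
    using assms Span_exp_base[OF base u_closed algebraic_u] simple_extension_eq by simp
  then obtain p where p: "p \<in> carrier (A[X])" "length p \<le> degree (Irr A u)" "x = eval p u"
    unfolding Span_eq_eval_img[OF base u_closed] by auto
  have sA: "set p \<subseteq> A"
    using p(1) polynomial_incl by (simp add: univ_poly_carrier[symmetric])
  then have sK: "set p \<subseteq> carrier K" using base_in_carrier by blast
  have cA: "coeff p i \<in> A" for i
    using sA by (induction p) (auto simp: base_closed(1))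
  \<comment> \<open>The list \<open>p\<close> may be too short; \<open>coeff\<close> returns zero
    beyond its length, which fills up the sum.\<close>
  have "x = (\<Oplus>i\<in>{..<degree (Irr A u)}. coeff p i \<otimes> u [^] i)"
    unfolding p(3) eval_eq_finsum[OF sK u_closed]
    using p(2) coeff_length[of p] sK u_closed
    by (intro add.finprod_mono_neutral_cong_left) auto
  with cA that[of "coeff p"] show thesis by blast
qed

end

text \<open>The degree of \<open>u\<close> is put into the assumptions to keep the Galois theory
  free of valuations; \<open>degree_Irr_eq\<close> supplies it later.\<close>

locale kummer_extension = radical_extension +
  fixes \<zeta> :: 'a
  assumes zeta_in: "\<zeta> \<in> A" and zeta_pow: "\<zeta> [^] q = \<one>"
    and zeta_primitive: "\<lbrakk>0 < m; m < q\<rbrakk> \<Longrightarrow> \<zeta> [^] (m::nat) \<noteq> \<one>"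
    and degree_Irr: "degree (Irr A u) = q"
begin

abbreviation F where "F \<equiv> K\<lparr>carrier := A\<rparr>"

lemmas zeta_closed = base_in_carrier[OF zeta_in]

section \<open>Roots of unity\<close>

lemma zeta_pow_pow: "(\<zeta> [^] (i::nat)) [^] q = \<one>"
  using zeta_pow zeta_closed by (metis mult.commute nat_pow_one nat_pow_pow)

lemma zeta_nonzero: "\<zeta> [^] (i::nat) \<noteq> \<zero>"
  using zeta_pow_pow[of i] q_pos by (metis nat_pow_zero neq0_conv zero_not_one)

lemma zeta_pow_inj: "inj_on (\<lambda>i::nat. \<zeta> [^] i) {..<q}"
proof (rule linorder_inj_onI)
  fix i j :: nat
  assume "i < j" and "j \<in> {..<q}"
  show "\<zeta> [^] i \<noteq> \<zeta> [^] j"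
  proof
    assume "\<zeta> [^] i = \<zeta> [^] j"
    moreover have "\<zeta> [^] i \<otimes> \<zeta> [^] (j - i) = \<zeta> [^] j"
      using \<open>i < j\<close> zeta_closed by (simp add: nat_pow_mult)
    ultimately have "\<zeta> [^] i \<otimes> \<zeta> [^] (j - i) = \<zeta> [^] i \<otimes> \<one>"
      using zeta_closed by simp
    then have "\<zeta> [^] (j - i) = \<one>"
      using m_lcancel[OF zeta_nonzero, of i "\<zeta> [^] (j - i)" \<one>] zeta_closed by simp
    with \<open>i < j\<close> \<open>j \<in> {..<q}\<close> zeta_primitive[of "j - i"] show False
      by (auto simp: less_imp_diff_less)
  qed
qed auto

text \<open>By counting: \<open>X^q - 1\<close> has at most \<open>q\<close> roots, and the powers
  of \<open>\<zeta>\<close> are already \<open>q\<close> distinct ones.\<close>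

lemma root_of_unity_is_power:
  assumes "x \<in> carrier K" "x [^] q = \<one>"
  obtains i where "i < q" "x = \<zeta> [^] i"
proof -
  let ?P = "binom_poly q \<one>" and ?S = "(\<lambda>i::nat. \<zeta> [^] i) ` {..<q}"
  have P: "?P \<in> carrier (poly_ring K)"
    by (rule binom_poly_closed[OF carrier_is_subring one_closed])
  have mem: "y \<in># roots ?P" if "y \<in> carrier K" "y [^] q = \<one>" for y
    using roots_mem_iff_is_root[OF P] that eval_binom_poly[OF q_pos one_closed]
    by (simp add: is_root_def) (simp add: binom_poly_def)
  have "insert x ?S \<subseteq> set_mset (roots ?P)"
    using mem assms zeta_closed zeta_pow_pow by auto
  then have "card (insert x ?S) \<le> card (set_mset (roots ?P))"
    by (intro card_mono) auto
  also have "\<dots> \<le> size (roots ?P)"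
    by (simp add: size_multiset_overloaded_eq) (metis card_eq_sum count_greater_eq_one_iff sum_mono)
  also have "\<dots> \<le> q"
    using size_roots_le_degree[OF P] length_binom_poly[OF q_pos, of \<one>] by simp
  finally have "x \<in> ?S"
    using card_image[OF zeta_pow_inj] by (cases "x \<in> ?S") auto
  with that show thesis by auto
qed

text \<open>Applied to the image of \<open>u\<close> under an automorphism, and to the norm of
  \<open>u\<close> compared with \<open>t\<close>.\<close>

lemma eq_root_of_unity_mult:
  assumes x: "x \<in> carrier K" and y: "y \<in> carrier K" "y \<noteq> \<zero>" and eq: "x [^] q = y [^] q"
  obtains i where "i < q" "x = \<zeta> [^] i \<otimes> y"
proof -
  have yU: "y \<in> Units K" using y field_Units by simp
  then have inv: "inv y \<in> carrier K" "y \<otimes> inv y = \<one>" "inv y \<otimes> y = \<one>" by simp_all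
  have "(x \<otimes> inv y) [^] q = (y \<otimes> inv y) [^] q"
    using nat_pow_distrib[OF x inv(1)] nat_pow_distrib[OF y(1) inv(1)] eq by simp
  then have "(x \<otimes> inv y) [^] q = \<one>" using inv by simp
  then obtain i where i: "i < q" "x \<otimes> inv y = \<zeta> [^] i"
    using root_of_unity_is_power[of "x \<otimes> inv y"] x inv by auto
  have "x = (x \<otimes> inv y) \<otimes> y"
    using x y inv by (simp add: m_assoc)
  with i that show thesis by simp
qed

section \<open>Conjugations of the Kummer extension\<close>

lemma coeffs_in_base: "p \<in> carrier (A[X]) \<Longrightarrow> set p \<subseteq> A"
  using polynomial_incl by (simp add: univ_poly_carrier[symmetric])

lemma coeffs_in_carrier: "p \<in> carrier (A[X]) \<Longrightarrow> set p \<subseteq> carrier K"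
  using coeffs_in_base base_in_carrier by blast

text \<open>Since \<open>u\<close> has degree \<open>q\<close>, its minimal polynomial is
  \<open>X^q - t\<close> up to a constant factor, and all \<open>\<zeta>^i u\<close> are roots of
  \<open>X^q - t\<close>.\<close>

lemma eval_conjugate_zero:
  assumes "p \<in> carrier (A[X])" "eval p u = \<zero>"
  shows "eval p (\<zeta> [^] (i::nat) \<otimes> u) = \<zero>"
proof -
  let ?w = "\<zeta> [^] i \<otimes> u"
  have w: "?w \<in> carrier K" using zeta_closed u_closed by simp
  note irr = IrrE(1)[OF base u_closed algebraic_u]
  have bin: "binom_poly q t \<in> carrier (A[X])" "binom_poly q t \<noteq> []"
    using binom_poly_closed[OF base_subring t_in] by (auto simp: binom_poly_def)
  obtain h where h: "h \<in> carrier (A[X])" "binom_poly q t = poly_mult (Irr A u) h"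
    using Irr_dvd[OF bin(1) eval_binom_u] .
  have nz: "Irr A u \<noteq> []" "h \<noteq> []"
    using h bin(2) poly_mult_zero(2)[OF coeffs_in_carrier[OF irr]] by auto
  then have "degree h = 0"
    using poly_mult_degree_eq[OF base_subring, of "Irr A u" h] irr h degree_Irr
      length_binom_poly[OF q_pos, of t]
    by (simp add: univ_poly_carrier)
  with nz obtain c where c: "h = [c]"
    by (cases h) auto
  then have c_nz: "c \<in> carrier K" "c \<noteq> \<zero>"
    using h(1) base_in_carrier by (auto simp: univ_poly_carrier[symmetric] polynomial_def)
  have "?w [^] q = t"
    using nat_pow_distrib[of "\<zeta> [^] i" u q] zeta_closed u_closed u_pow zeta_pow_pow base_in_carrier[OF t_in] by simp
  then have "eval (binom_poly q t) ?w = \<zero>"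
    using eval_binom_poly[OF q_pos base_in_carrier[OF t_in] w] base_in_carrier[OF t_in] by simp
  then have "eval (Irr A u) ?w \<otimes> c = \<zero>"
    using eval_poly_mult[OF coeffs_in_carrier[OF irr] coeffs_in_carrier[OF h(1)] w] h(2) c c_nz
    by simp
  then have "eval (Irr A u) ?w = \<zero>"
    using c_nz integral_iff eval_in_carrier[OF coeffs_in_carrier[OF irr] w] by simp
  moreover obtain g where "g \<in> carrier (A[X])" "p = poly_mult (Irr A u) g"
    using Irr_dvd[OF assms] .
  ultimately show ?thesis
    using eval_poly_mult[OF coeffs_in_carrier[OF irr] coeffs_in_carrier w]
      eval_in_carrier[OF coeffs_in_carrier w] by simp
qed

text \<open>Well defined on \<open>u\<close>-polynomials because \<open>u\<close> and \<open>\<zeta> [^] i \<otimes> u\<close> are roots of the same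
  irreducible polynomial.\<close>

definition conj_map :: "nat \<Rightarrow> 'a \<Rightarrow> 'a"
  where "conj_map i = (\<lambda>x\<in>carrier K. eval (SOME p. p \<in> carrier (A[X]) \<and> eval p u = x) (\<zeta> [^] i \<otimes> u))"

lemma carrier_evalE:
  assumes "x \<in> carrier K"
  obtains p where "p \<in> carrier (A[X])" "x = eval p u"
  using assms simple_extension_eq simple_extension_as_eval_img[of A u] base_in_carrier u_closed
  by blast

lemma conj_map_eval:
  assumes "p \<in> carrier (A[X])"
  shows "conj_map i (eval p u) = eval p (\<zeta> [^] i \<otimes> u)"
proof -
  let ?w = "\<zeta> [^] i \<otimes> u"
  have w: "?w \<in> carrier K" using zeta_closed u_closed by simp
  interpret U: ring_hom_cring "A[X]" K "\<lambda>p. eval p u"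
    by (rule eval_cring_hom[OF base_subring u_closed])
  interpret W: ring_hom_cring "A[X]" K "\<lambda>p. eval p ?w"
    by (rule eval_cring_hom[OF base_subring w])
  define p' where "p' = (SOME p'. p' \<in> carrier (A[X]) \<and> eval p' u = eval p u)"
  have p': "p' \<in> carrier (A[X]) \<and> eval p' u = eval p u"
    unfolding p'_def by (rule someI[of _ p]) (use assms in simp)
  have "eval (p' \<ominus>\<^bsub>A[X]\<^esub> p) ?w = \<zero>"
    by (rule eval_conjugate_zero) (use p' assms in simp_all)
  then have "eval p' ?w = eval p ?w"
    using p' assms by simp
  then show ?thesis
    using assms by (simp add: conj_map_def p'_def)
qed

lemma conj_map_closed: "x \<in> carrier K \<Longrightarrow> conj_map i x \<in> carrier K"
  by (erule carrier_evalE) (use zeta_closed u_closed coeffs_in_carrier in \<open>auto simp: conj_map_eval eval_in_carrier\<close>)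

lemma conj_map_hom: "conj_map i \<in> ring_hom K K"
proof (rule ring_hom_memI)
  have w: "\<zeta> [^] i \<otimes> u \<in> carrier K" using zeta_closed u_closed by simp
  interpret U: ring_hom_cring "A[X]" K "\<lambda>p. eval p u"
    by (rule eval_cring_hom[OF base_subring u_closed])
  interpret W: ring_hom_cring "A[X]" K "\<lambda>p. eval p (\<zeta> [^] i \<otimes> u)"
    by (rule eval_cring_hom[OF base_subring w])
  show "conj_map i x \<in> carrier K" if "x \<in> carrier K" for x
    by (rule conj_map_closed[OF that])
  fix x y assume "x \<in> carrier K" "y \<in> carrier K"
  then obtain p r where p: "p \<in> carrier (A[X])" "x = eval p u" and r: "r \<in> carrier (A[X])" "y = eval r u"
    by (metis carrier_evalE)
  show "conj_map i (x \<otimes> y) = conj_map i x \<otimes> conj_map i y"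
    using conj_map_eval[of "p \<otimes>\<^bsub>A[X]\<^esub> r" i] p r by (simp add: conj_map_eval)
  show "conj_map i (x \<oplus> y) = conj_map i x \<oplus> conj_map i y"
    using conj_map_eval[of "p \<oplus>\<^bsub>A[X]\<^esub> r" i] p r by (simp add: conj_map_eval)
next
  have "[\<one>] \<in> carrier (A[X])"
    using base_closed(2) by (simp add: univ_poly_carrier[symmetric] polynomial_def)
  from conj_map_eval[OF this] show "conj_map i \<one> = \<one>"
    using zeta_closed u_closed by simp
qed

lemma conj_map_ring_hom_cring: "ring_hom_cring K K (conj_map i)"
  by (rule ring_hom_cringI[OF is_cring is_cring conj_map_hom])

lemma conj_map_base:
  assumes "a \<in> A"
  shows "conj_map i a = a"
proof (cases "a = \<zero>")
  case True
  then show ?thesis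
    using ring_hom_cring.hom_zero[OF conj_map_ring_hom_cring] by simp
next
  case False
  then have "[a] \<in> carrier (A[X])"
    using assms by (simp add: univ_poly_carrier[symmetric] polynomial_def)
  from conj_map_eval[OF this] show ?thesis
    using assms base_in_carrier zeta_closed u_closed by simp
qed

lemma conj_map_u: "conj_map i u = \<zeta> [^] i \<otimes> u"
  using conj_map_eval[OF var_closed(1)[OF base_subring]] u_closed zeta_closed by (simp add: eval_var)

text \<open>Makes an automorphism over \<open>A\<close> determined by its value at \<open>u\<close>,
  for composing conjugations as well as for recognizing an arbitrary automorphism as one of
  them.\<close>

lemma hom_eval_base:
  assumes "h \<in> ring_hom K K" "\<And>a. a \<in> A \<Longrightarrow> h a = a" "p \<in> carrier (A[X])" "y \<in> carrier K"
  shows "h (eval p y) = eval p (h y)"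
proof -
  interpret h: ring_hom_ring K K h
    by (rule ring_hom_ringI2[OF ring_axioms ring_axioms assms(1)])
  have "map h p = p"
    using assms(2) coeffs_in_base[OF assms(3)] by (intro map_idI) auto
  then show ?thesis
    using h.eval_hom[OF base_subring assms(4,3)] by simp
qed

lemma conj_map_comp:
  assumes "x \<in> carrier K"
  shows "conj_map i (conj_map j x) = conj_map (i + j) x"
proof -
  obtain p where p: "p \<in> carrier (A[X])" "x = eval p u"
    using carrier_evalE[OF assms] .
  interpret h: ring_hom_cring K K "conj_map i" by (rule conj_map_ring_hom_cring)
  have "conj_map i (\<zeta> [^] j \<otimes> u) = \<zeta> [^] (i + j) \<otimes> u"
    using zeta_closed u_closed conj_map_base[OF base_pow[OF zeta_in]]
    by (simp add: conj_map_u nat_pow_mult[symmetric] m_ac)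
  then show ?thesis
    using hom_eval_base[OF conj_map_hom conj_map_base p(1)] p zeta_closed u_closed
    by (simp add: conj_map_eval)
qed

lemma conj_map_eqI:
  assumes "\<zeta> [^] i = \<zeta> [^] j"
  shows "conj_map i = conj_map j"
  using assms by (simp add: conj_map_def)

lemma conj_map_mod: "conj_map (i mod q) = conj_map i"
proof (rule conj_map_eqI)
  have "\<zeta> [^] i = \<zeta> [^] (q * (i div q)) \<otimes> \<zeta> [^] (i mod q)"
    using zeta_closed by (simp add: nat_pow_mult)
  also have "\<zeta> [^] (q * (i div q)) = \<one>"
    using zeta_closed zeta_pow nat_pow_pow[OF zeta_closed, of q "i div q"] by simp
  finally show "\<zeta> [^] (i mod q) = \<zeta> [^] i"
    using zeta_closed by simp
qed

lemma conj_map_0: "conj_map 0 = (\<lambda>x\<in>carrier K. x)"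
proof
  fix x
  show "conj_map 0 x = (\<lambda>x\<in>carrier K. x) x"
  proof (cases "x \<in> carrier K")
    case True
    then obtain p where "p \<in> carrier (A[X])" "x = eval p u"
      by (rule carrier_evalE)
    then show ?thesis
      using True u_closed by (simp add: conj_map_eval)
  qed (simp add: conj_map_def)
qed

text \<open>Indices matter only modulo \<open>q\<close>, and \<open>i * (q - 1)\<close> represents
  \<open>-i\<close> there, so natural numbers suffice as indices.\<close>

lemma conj_map_inverse: "x \<in> carrier K \<Longrightarrow> conj_map (i * (q - 1)) (conj_map i x) = x"
  "x \<in> carrier K \<Longrightarrow> conj_map i (conj_map (i * (q - 1)) x) = x"
proof -
  have "i * (q - 1) + i = i * q" "i + i * (q - 1) = i * q"
    using q_pos by (auto simp: algebra_simps)
  moreover have "conj_map (i * q) = conj_map 0"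
    using conj_map_mod[of "i * q"] by simp
  ultimately show "x \<in> carrier K \<Longrightarrow> conj_map (i * (q - 1)) (conj_map i x) = x"
    "x \<in> carrier K \<Longrightarrow> conj_map i (conj_map (i * (q - 1)) x) = x"
    by (simp_all only: conj_map_comp) (simp_all add: conj_map_0)
qed

section \<open>The Galois group and its fixed field\<close>

lemma conj_map_Bij: "conj_map i \<in> Bij (carrier K)"
proof -
  have "bij_betw (conj_map i) (carrier K) (carrier K)"
    by (rule bij_betw_byWitness[where f' = "conj_map (i * (q - 1))"])
      (auto simp: conj_map_inverse conj_map_closed simp del: One_nat_def)
  then show ?thesis
    by (simp add: Bij_def conj_map_def)
qed

text \<open>An automorphism over \<open>A\<close> preserves the equation \<open>u^q = t\<close>, so
  it sends \<open>u\<close> to some \<open>\<zeta>^i u\<close> and agrees with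
  \<open>conj_map i\<close>, because \<open>u\<close> generates \<open>K\<close>.\<close>

lemma carrier_galois_group: "carrier (galois_group K F) = range conj_map"
proof (intro equalityI subsetI)
  fix s assume "s \<in> carrier (galois_group K F)"
  then have s: "s \<in> ring_hom K K" "s \<in> extensional (carrier K)" "\<And>a. a \<in> A \<Longrightarrow> s a = a"
    by (auto simp: galois_group_def ring_iso_def)
  interpret s: ring_hom_ring K K s
    by (rule ring_hom_ringI2[OF ring_axioms ring_axioms s(1)])
  have "s u [^] q = u [^] q"
    using s.hom_nat_pow[OF u_closed] u_pow s(3)[OF t_in] by metis
  then obtain i where su: "s u = \<zeta> [^] (i::nat) \<otimes> u"
    using eq_root_of_unity_mult[OF s.hom_closed[OF u_closed] u_closed u_nonzero] by blast
  have "s = conj_map i"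
  proof (rule extensionalityI[OF s(2)])
    show "conj_map i \<in> extensional (carrier K)" by (simp add: conj_map_def)
    fix x assume "x \<in> carrier K"
    then obtain p where "p \<in> carrier (A[X])" "x = eval p u"
      by (rule carrier_evalE)
    then show "s x = conj_map i x"
      using hom_eval_base[OF s(1,3) _ u_closed] su by (simp add: conj_map_eval)
  qed
  then show "s \<in> range conj_map" by simp
next
  fix s assume "s \<in> range conj_map"
  then obtain i where "s = conj_map i" by blast
  then show "s \<in> carrier (galois_group K F)"
    using conj_map_Bij[of i] conj_map_hom[of i]
    by (auto simp: galois_group_def ring_iso_def conj_map_base Bij_def)
qed

lemma mult_galois_group:
  "conj_map i \<otimes>\<^bsub>galois_group K F\<^esub> conj_map j = conj_map (i + j)"
proof -
  have "compose (carrier K) (conj_map i) (conj_map j) = conj_map (i + j)"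
    by (rule extensionalityI[of _ "carrier K"])
      (auto simp: compose_def conj_map_comp, simp add: conj_map_def)
  then show ?thesis
    by (simp add: galois_group_def BijGroup_def conj_map_Bij)
qed

lemma one_galois_group: "\<one>\<^bsub>galois_group K F\<^esub> = conj_map 0"
  by (simp add: galois_group_def BijGroup_def conj_map_0)

lemma group_galois_group: "group (galois_group K F)"
proof (rule groupI)
  fix x assume "x \<in> carrier (galois_group K F)"
  then obtain i where i: "x = conj_map i"
    unfolding carrier_galois_group by blast
  have "i * (q - 1) + i = i * q"
    using q_pos by (auto simp: algebra_simps)
  then have "conj_map (i * (q - 1)) \<otimes>\<^bsub>galois_group K F\<^esub> x = \<one>\<^bsub>galois_group K F\<^esub>"
    using conj_map_mod[of "i * q"] by (simp add: i mult_galois_group one_galois_group)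
  then show "\<exists>y\<in>carrier (galois_group K F). y \<otimes>\<^bsub>galois_group K F\<^esub> x = \<one>\<^bsub>galois_group K F\<^esub>"
    unfolding carrier_galois_group by blast
qed (auto simp: carrier_galois_group mult_galois_group one_galois_group add.assoc)

lemma cyclic_galois_group: "cyclic_group (galois_group K F)"
proof -
  interpret G: group "galois_group K F" by (rule group_galois_group)
  have pow: "conj_map 1 [^]\<^bsub>galois_group K F\<^esub> n = conj_map n" for n :: nat
    by (induction n) (simp_all add: one_galois_group mult_galois_group)
  have "range conj_map = range (\<lambda>n::int. conj_map 1 [^]\<^bsub>galois_group K F\<^esub> n)"
  proof (intro equalityI image_subsetI)
    fix n :: nat
    have "conj_map n = conj_map 1 [^]\<^bsub>galois_group K F\<^esub> int n"
      by (simp only: int_pow_int pow)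
    then show "conj_map n \<in> range (\<lambda>n::int. conj_map 1 [^]\<^bsub>galois_group K F\<^esub> n)" by blast
  next
    fix n :: int
    show "conj_map 1 [^]\<^bsub>galois_group K F\<^esub> n \<in> range conj_map"
      using G.int_pow_closed[of "conj_map 1" n] by (simp add: carrier_galois_group)
  qed
  then show ?thesis
    unfolding G.cyclic_group carrier_galois_group by blast
qed

lemma range_conj_map: "range conj_map = conj_map ` {..<q}"
proof (intro equalityI image_subsetI)
  fix i
  have "conj_map i = conj_map (i mod q)" "i mod q \<in> {..<q}"
    using conj_map_mod q_pos by auto
  then show "conj_map i \<in> conj_map ` {..<q}" by blast
qed auto

lemma finite_range_conj_map: "finite (range conj_map)"
  by (simp add: range_conj_map)

lemma card_range_conj_map: "card (range conj_map) = q"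
proof -
  have "inj_on conj_map {..<q}"
  proof (rule inj_onI)
    fix i j assume ij: "i \<in> {..<q}" "j \<in> {..<q}" "conj_map i = conj_map j"
    then have "\<zeta> [^] i \<otimes> u = \<zeta> [^] j \<otimes> u"
      using conj_map_u by metis
    then have "\<zeta> [^] i = \<zeta> [^] j"
      using m_rcancel[OF u_nonzero u_closed] zeta_closed by simp
    with ij show "i = j"
      using inj_onD[OF zeta_pow_inj] by blast
  qed
  then show ?thesis
    by (simp add: range_conj_map card_image)
qed

text \<open>The generator multiplies the coordinate at \<open>u^i\<close> by
  \<open>\<zeta>^i\<close>. For a fixed element this gives \<open>a_i (\<zeta>^i - 1) = 0\<close>,
  which leaves only the coordinate at \<open>i = 0\<close>.\<close>

lemma fixed_by_conj_map:
  assumes x: "x \<in> carrier K" and fixed: "conj_map 1 x = x"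
  shows "x \<in> A"
proof -
  have distr: "a \<otimes> (b \<ominus> \<one>) \<otimes> c \<oplus> a \<otimes> c = a \<otimes> (b \<otimes> c)"
    if "a \<in> carrier K" "b \<in> carrier K" "c \<in> carrier K" for a b c
    using that by algebra
  interpret h: ring_hom_cring K K "conj_map 1" by (rule conj_map_ring_hom_cring)
  obtain a where ran: "range a \<subseteq> A" and x_eq: "x = (\<Oplus>i\<in>{..<q}. a i \<otimes> u [^] i)"
    by (rule powers_span[OF x, unfolded degree_Irr])
  have aA: "a i \<in> A" for i using ran by blast
  have aK: "a i \<in> carrier K" for i using aA base_in_carrier by blast
  \<comment> \<open>These are the coordinates of the difference between \<open>conj_map 1 x\<close>
    and \<open>x\<close>.\<close>
  define b where "b i = a i \<otimes> (\<zeta> [^] i \<ominus> \<one>)" for i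
  have b: "b i \<in> A" for i
    using aA[of i] base_pow[OF zeta_in, of i] by (simp add: b_def minus_eq base_closed)
  have "(\<Oplus>i\<in>{..<q}. b i \<otimes> u [^] i) \<oplus> x = (\<Oplus>i\<in>{..<q}. b i \<otimes> u [^] i \<oplus> a i \<otimes> u [^] i)"
    unfolding x_eq using aK base_in_carrier[OF b] u_closed by (subst finsum_addf) auto
  also have "\<dots> = (\<Oplus>i\<in>{..<q}. (conj_map 1 \<circ> (\<lambda>i. a i \<otimes> u [^] i)) i)"
  proof (rule finsum_cong')
    fix i
    have "conj_map 1 (a i \<otimes> u [^] i) = a i \<otimes> (\<zeta> [^] i \<otimes> u [^] i)"
      using aK[of i] u_closed zeta_closed conj_map_base[OF aA]
      by (simp add: h.ring.hom_nat_pow conj_map_u nat_pow_distrib del: One_nat_def)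
    moreover have "b i \<otimes> u [^] i \<oplus> a i \<otimes> u [^] i = a i \<otimes> (\<zeta> [^] i \<otimes> u [^] i)"
      unfolding b_def by (rule distr) (use aK zeta_closed u_closed in auto)
    ultimately show "b i \<otimes> u [^] i \<oplus> a i \<otimes> u [^] i = (conj_map 1 \<circ> (\<lambda>i. a i \<otimes> u [^] i)) i"
      by simp
  qed (use aK u_closed conj_map_closed in auto)
  also have "\<dots> = x"
    using fixed h.hom_finsum[of "\<lambda>i. a i \<otimes> u [^] i" "{..<q}"] aK u_closed x_eq by simp
  finally have "(\<Oplus>i\<in>{..<q}. b i \<otimes> u [^] i) = \<zero>"
    using x base_in_carrier[OF b] u_closed by (intro add.r_cancel_one[THEN iffD1, of x]) auto
  then have b0: "b i = \<zero>" if "i < q" for i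
    using powers_independent[of q b i] b that degree_Irr by simp
  have a0: "a i = \<zero>" if "0 < i" "i < q" for i
    using b0[OF that(2)] zeta_primitive[OF that] aK[of i] zeta_closed
    by (auto simp: b_def integral_iff)
  have "x = (\<Oplus>i\<in>{0}. a i \<otimes> u [^] i)"
    unfolding x_eq using a0 aK u_closed q_pos
    by (intro add.finprod_mono_neutral_cong_right) auto
  also have "\<dots> = a 0"
    using aK by (simp add: finsum_singleton)
  finally show ?thesis using aA by simp
qed

lemma base_proper: "u \<notin> A"
proof
  assume "u \<in> A"
  then have "conj_map 1 u = u" by (rule conj_map_base)
  then have "\<zeta> [^] (1::nat) \<otimes> u = \<one> \<otimes> u"
    using u_closed by (simp add: conj_map_u)
  then have "\<zeta> [^] (1::nat) = \<one>"
    using m_rcancel[OF u_nonzero u_closed] zeta_closed by (metis nat_pow_closed one_closed)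
  then show False
    using zeta_primitive[of 1] prime_gt_1_nat[OF prime_q] by simp
qed

lemma field_extension_base: "field_extension K F"
  by (simp add: field_extension_def field_axioms base)

theorem cyclic_extension_base: "cyclic_extension K F"
proof -
  have "{x \<in> carrier K. \<forall>s \<in> range conj_map. s x = x} = A"
    using fixed_by_conj_map base_in_carrier by (auto simp: conj_map_base)
  moreover have "finite_dimension A (carrier K)"
    using dimension_degree finite_dimensionI by blast
  ultimately show ?thesis
    using cyclic_galois_group field_extension_base
    by (simp add: cyclic_extension_def galois_extension_def carrier_galois_group)
qed

section \<open>The norm as a product of conjugates\<close>

lemma field_norm_eq: "field_norm K F x = (\<Otimes>s\<in>range conj_map. s x)"
  by (simp add: field_norm_def carrier_galois_group)

lemma range_conj_map_closed: "\<lbrakk>s \<in> range conj_map; x \<in> carrier K\<rbrakk> \<Longrightarrow> s x \<in> carrier K"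
  using conj_map_closed by auto

lemma field_norm_closed: "x \<in> carrier K \<Longrightarrow> field_norm K F x \<in> carrier K"
  unfolding field_norm_eq using range_conj_map_closed by (intro finprod_closed) auto

lemma field_norm_mult:
  assumes "x \<in> carrier K" "y \<in> carrier K"
  shows "field_norm K F (x \<otimes> y) = field_norm K F x \<otimes> field_norm K F y"
proof -
  have "field_norm K F (x \<otimes> y) = (\<Otimes>s\<in>range conj_map. s x \<otimes> s y)"
    unfolding field_norm_eq
    by (rule finprod_cong') (use assms conj_map_hom in \<open>auto simp: conj_map_closed ring_hom_mult\<close>)
  then show ?thesis
    unfolding field_norm_eq using assms range_conj_map_closed by (subst (asm) finprod_multf) auto
qed

lemma field_norm_base:
  assumes "a \<in> A"
  shows "field_norm K F a = a [^] q"
proof -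
  have "field_norm K F a = (\<Otimes>s\<in>range conj_map. a)"
    unfolding field_norm_eq
    by (rule finprod_cong') (use assms base_in_carrier in \<open>auto simp: conj_map_base\<close>)
  also have "\<dots> = a [^] card (range conj_map)"
    by (rule finprod_const[OF base_in_carrier[OF assms]])
  finally show ?thesis
    by (simp add: card_range_conj_map)
qed

lemma field_norm_pow:
  assumes "x \<in> carrier K"
  shows "field_norm K F (x [^] (n::nat)) = field_norm K F x [^] n"
  using assms field_norm_closed field_norm_base[of \<one>] base_closed(2)
  by (induction n) (auto simp: field_norm_mult)

text \<open>Fixes the norm of \<open>u\<close> up to a \<open>q\<close>-th root of unity. Value and
  membership in \<open>A\<close> follow from that, so the sign in \<open>N(u) = (-1)^(q-1) t\<close>
  need not be determined.\<close>

lemma field_norm_u_pow: "field_norm K F u [^] q = t [^] q"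
  using field_norm_pow[OF u_closed, of q] u_pow field_norm_base[OF t_in] by simp

lemma field_norm_u_in_base: "field_norm K F u \<in> A"
proof -
  let ?n = "field_norm K F u"
  have n: "?n \<in> carrier K" by (rule field_norm_closed[OF u_closed])
  obtain i where "?n = \<zeta> [^] (i::nat) \<otimes> t"
    using eq_root_of_unity_mult[OF n base_in_carrier[OF t_in] t_nonzero field_norm_u_pow] .
  then show ?thesis
    using base_closed(4) base_pow[OF zeta_in] t_in by simp
qed

end

section \<open>Values of monomials\<close>

text \<open>The assumption \<open>separated\<close> is the distinctness of the cosets, restated as:
  monomials with different exponents below \<open>q\<close> never have the same value.\<close>

locale valued_radical_extension = radical_extension +
  fixes v :: "'a \<Rightarrow> 'g::linordered_ab_group_add"
  assumes valued: "valued_field (K\<lparr>carrier := A\<rparr>) v"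
    and separated: "\<lbrakk>c \<in> A - {\<zero>}; d \<in> A - {\<zero>}; i < q; j < q; v (c [^] q \<otimes> t [^] i) = v (d [^] q \<otimes> t [^] j)\<rbrakk>
      \<Longrightarrow> i = j"
begin

lemmas v_mult = valued_field.v_mult[OF valued, simplified]
  and v_one = valued_field.v_one[OF valued, simplified]
  and v_add = valued_field.v_add[OF valued, simplified]
  and v_add_eq = valued_field.v_add_eq[OF valued, simplified]

lemma base_pow_nonzero: "c \<in> A - {\<zero>} \<Longrightarrow> c [^] (n::nat) \<in> A - {\<zero>}"
  using valued_field.pow_nonzero[OF valued, of c n] by (simp add: nat_pow_def)

lemma base_mult_nonzero: "\<lbrakk>c \<in> A - {\<zero>}; d \<in> A - {\<zero>}\<rbrakk> \<Longrightarrow> c \<otimes> d \<in> A - {\<zero>}"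
  using base_closed(4) base_in_carrier by (auto simp: integral_iff)

lemma t_base: "t \<in> A - {\<zero>}"
  using t_in t_nonzero by simp

lemma v_pow_Suc: "c \<in> A - {\<zero>} \<Longrightarrow> v (c [^] (n::nat) \<otimes> c) = v (c [^] n) + v c"
  using v_mult[of "c [^] n" c] base_pow_nonzero[of c n] by simp

lemma v_pow_mono: "\<lbrakk>c \<in> A - {\<zero>}; d \<in> A - {\<zero>}; v c \<le> v d\<rbrakk> \<Longrightarrow> v (c [^] (n::nat)) \<le> v (d [^] n)"
  by (induction n) (auto simp: v_pow_Suc intro: add_mono)

lemma v_pow_strict_mono:
  "\<lbrakk>c \<in> A - {\<zero>}; d \<in> A - {\<zero>}; v c < v d; n > 0\<rbrakk> \<Longrightarrow> v (c [^] (n::nat)) < v (d [^] n)"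
  using v_pow_mono[of c d "n - 1"]
  by (cases n) (auto simp: v_pow_Suc intro: add_le_less_mono)

lemma v_pow_cong: "\<lbrakk>c \<in> A - {\<zero>}; d \<in> A - {\<zero>}; v c = v d\<rbrakk> \<Longrightarrow> v (c [^] (n::nat)) = v (d [^] n)"
  using v_pow_mono[of c d n] v_pow_mono[of d c n] by auto

text \<open>An ordered group is torsion-free, so the factor \<open>q\<close> introduced to avoid
  division can be cancelled again.\<close>

lemma v_pow_inj:
  "\<lbrakk>c \<in> A - {\<zero>}; d \<in> A - {\<zero>}; v (c [^] (n::nat)) = v (d [^] n); n > 0\<rbrakk> \<Longrightarrow> v c = v d"
  using v_pow_strict_mono[of c d n] v_pow_strict_mono[of d c n]
  by (metis less_irrefl linorder_less_linear)

text \<open>The value of the monomial \<open>c \<otimes> u [^] i\<close>, multiplied by \<open>q\<close> so that it lies in the value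
  group of the base field.\<close>

definition mval :: "'a \<Rightarrow> nat \<Rightarrow> 'g"
  where "mval c i = v (c [^] q \<otimes> t [^] i)"

lemma mval_eq: "c \<in> A - {\<zero>} \<Longrightarrow> mval c i = v (c [^] q) + v (t [^] i)"
  unfolding mval_def using v_mult[of "c [^] q" "t [^] i"] base_pow_nonzero t_base by simp

lemma v_pow_mult:
  assumes "c \<in> A - {\<zero>}" "d \<in> A - {\<zero>}"
  shows "v ((c \<otimes> d) [^] (n::nat)) = v (c [^] n) + v (d [^] n)"
  using assms nat_pow_distrib[of c d n] base_in_carrier v_mult[of "c [^] n" "d [^] n"]
    base_pow_nonzero[of c n] base_pow_nonzero[of d n] by simp

lemma v_pow_add:
  assumes "c \<in> A - {\<zero>}"
  shows "v (c [^] (m + n::nat)) = v (c [^] m) + v (c [^] n)"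
  using assms nat_pow_mult[of c m n] base_in_carrier v_mult[of "c [^] m" "c [^] n"]
    base_pow_nonzero[of c] by simp

text \<open>The exponents add without reduction modulo \<open>q\<close>: \<open>mval\<close> is
  defined for every exponent, and this is what makes it additive.\<close>

lemma mval_mult:
  assumes "c \<in> A - {\<zero>}" "d \<in> A - {\<zero>}"
  shows "mval (c \<otimes> d) (i + j) = mval c i + mval d j"
  using assms base_mult_nonzero[OF assms] t_base
  by (simp add: mval_eq v_pow_mult v_pow_add add_ac)

lemma mval_add_greater:
  assumes "c \<in> A" "d \<in> A" "c = \<zero> \<or> g < mval c i" "d = \<zero> \<or> g < mval d i"
  shows "c \<oplus> d = \<zero> \<or> g < mval (c \<oplus> d) i"
proof (cases "c = \<zero> \<or> d = \<zero> \<or> c \<oplus> d = \<zero>")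
  case True
  then show ?thesis using assms base_in_carrier by auto
next
  case False
  have le: "mval x i \<le> mval y i" if "x \<in> A - {\<zero>}" "y \<in> A - {\<zero>}" "v x \<le> v y" for x y
    using that v_pow_mono[of x y q] by (simp add: mval_eq)
  have "min (v c) (v d) \<le> v (c \<oplus> d)"
    using False assms by (intro v_add) auto
  then have "mval c i \<le> mval (c \<oplus> d) i \<or> mval d i \<le> mval (c \<oplus> d) i"
    using le[of c "c \<oplus> d"] le[of d "c \<oplus> d"] False assms base_closed(5) by (auto simp: min_le_iff_disj)
  then show ?thesis using False assms by auto
qed

lemma mval_add_eq:
  assumes c: "c \<in> A - {\<zero>}" and d: "d \<in> A" "d = \<zero> \<or> mval c i < mval d i"
  shows "c \<oplus> d \<noteq> \<zero>" "mval (c \<oplus> d) i = mval c i"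
proof -
  have "d = \<zero> \<or> v c < v d"
    using d v_pow_mono[of d c q] c by (cases "d = \<zero>") (auto simp: mval_eq not_le[symmetric])
  note eq = v_add_eq[OF _ _ this]
  show nz: "c \<oplus> d \<noteq> \<zero>" using eq(1) c d by simp
  have "v (c \<oplus> d) = v c" using eq(2) c d by simp
  then show "mval (c \<oplus> d) i = mval c i"
    using v_pow_cong[of "c \<oplus> d" c q] nz c d base_closed(5) by (simp add: mval_eq)
qed

lemma mval_finsum_greater:
  assumes "finite S" "\<And>s. s \<in> S \<Longrightarrow> f s \<in> A" "\<And>s. s \<in> S \<Longrightarrow> f s = \<zero> \<or> g < mval (f s) i"
  shows "(\<Oplus>s\<in>S. f s) \<in> A \<and> ((\<Oplus>s\<in>S. f s) = \<zero> \<or> g < mval (\<Oplus>s\<in>S. f s) i)"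
  using assms
proof (induction S)
  case empty
  then show ?case by (simp add: base_closed(1))
next
  case (insert s S)
  then have "(\<Oplus>s\<in>insert s S. f s) = f s \<oplus> (\<Oplus>s\<in>S. f s)"
    using base_in_carrier by (intro finsum_insert) auto
  then show ?case
    using insert mval_add_greater[of "f s" "\<Oplus>s\<in>S. f s"] base_closed(5) by simp
qed

text \<open>Needed for the constant coefficient of \<open>X^q - t\<close>. Twice
  \<open>v (-1)\<close> is zero, hence \<open>v (-1)\<close> is.\<close>

lemma mval_minus:
  assumes "c \<in> A - {\<zero>}"
  shows "\<ominus> c \<in> A - {\<zero>}" "mval (\<ominus> c) i = mval c i"
proof -
  have cK: "c \<in> carrier K" using assms base_in_carrier by simp
  have m1: "\<ominus> \<one> \<in> A - {\<zero>}" using base_closed(2,3) by auto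
  have "v (\<ominus> \<one>) + v (\<ominus> \<one>) = 0"
    using v_mult[of "\<ominus> \<one>" "\<ominus> \<one>"] m1 v_one by (simp add: l_minus)
  then have "v (\<ominus> \<one>) = 0" by simp
  moreover have eq: "\<ominus> c = \<ominus> \<one> \<otimes> c" using cK by (simp add: l_minus)
  ultimately have "v (\<ominus> c) = v c"
    using v_mult[of "\<ominus> \<one>" c] m1 assms by simp
  moreover show "\<ominus> c \<in> A - {\<zero>}" unfolding eq by (rule base_mult_nonzero[OF m1 assms])
  ultimately show "mval (\<ominus> c) i = mval c i"
    using v_pow_cong[of "\<ominus> c" c q] assms by (simp add: mval_eq)
qed

text \<open>A minimum over finitely many indices exists, and \<open>separated\<close> excludes a
  tie. Both the irreducibility argument and the splitting off of a leading monomial rest on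
  this.\<close>

lemma minimal_term:
  assumes a: "\<And>i. a i \<in> A" and nonzero: "j < q" "a j \<noteq> \<zero>"
  obtains i where "i < q" "a i \<noteq> \<zero>"
    "\<And>k. \<lbrakk>k < q; k \<noteq> i; a k \<noteq> \<zero>\<rbrakk> \<Longrightarrow> mval (a i) i < mval (a k) k"
proof -
  let ?S = "{i. i < q \<and> a i \<noteq> \<zero>}"
  have S: "finite ?S" "?S \<noteq> {}" using nonzero by auto
  define i where "i = arg_min_on (\<lambda>i. mval (a i) i) ?S"
  have i: "i \<in> ?S" unfolding i_def by (rule arg_min_if_finite(1)[OF S])
  have "mval (a i) i < mval (a k) k" if "k \<in> ?S" "k \<noteq> i" for k
  proof -
    have "mval (a i) i \<le> mval (a k) k"
      unfolding i_def by (rule arg_min_least[OF S that(1)])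
    moreover have "mval (a i) i \<noteq> mval (a k) k"
      using separated[of "a i" "a k" i k] i that a by (auto simp: mval_def)
    ultimately show ?thesis by simp
  qed
  with i that[of i] show thesis by simp
qed

text \<open>A Newton polygon argument: in a product of two polynomials of degree less than \<open>q\<close>, the
  minimum of the monomial values is attained exactly once, whereas the polynomial with
  coefficients \<open>\<ominus> t\<close> and \<open>\<one>\<close> attains it at both of its terms.\<close>

lemma no_proper_factorization:
  assumes a: "\<And>i. a i \<in> A" "\<And>i. i \<ge> q \<Longrightarrow> a i = \<zero>" "a i' \<noteq> \<zero>"
    and b: "\<And>i. b i \<in> A" "\<And>i. i \<ge> q \<Longrightarrow> b i = \<zero>" "b j' \<noteq> \<zero>"
    and prod: "\<And>k. (\<Oplus>i\<in>{..k}. a i \<otimes> b (k - i)) = (if k = q then \<one> else if k = 0 then \<ominus> t else \<zero>)"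
  shows False
proof -
  have "i' < q" "j' < q" using a b by (meson leI)+
  obtain i where i: "i < q" "a i \<noteq> \<zero>"
    "\<And>k. \<lbrakk>k < q; k \<noteq> i; a k \<noteq> \<zero>\<rbrakk> \<Longrightarrow> mval (a i) i < mval (a k) k"
    using minimal_term[of a i'] a \<open>i' < q\<close> by blast
  obtain j where j: "j < q" "b j \<noteq> \<zero>"
    "\<And>k. \<lbrakk>k < q; k \<noteq> j; b k \<noteq> \<zero>\<rbrakk> \<Longrightarrow> mval (b j) j < mval (b k) k"
    using minimal_term[of b j'] b \<open>j' < q\<close> by blast
  define g where "g = mval (a i) i + mval (b j) j"
  define c where "c k = (\<Oplus>i\<in>{..k}. a i \<otimes> b (k - i))" for k
  have abA: "a k \<otimes> b l \<in> A" for k l using a(1) b(1) base_closed(4) by blast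
  \<comment> \<open>Both factors are at least minimal and one of them is strictly larger, since each
    minimum is attained only once.\<close>
  have other: "a k \<otimes> b l = \<zero> \<or> g < mval (a k \<otimes> b l) (k + l)" if "k \<noteq> i \<or> l \<noteq> j" for k l
  proof (cases "a k = \<zero> \<or> b l = \<zero>")
    case True
    then show ?thesis using a(1) b(1) base_in_carrier by auto
  next
    case False
    then have "k < q" "l < q" using a(2) b(2) by (meson leI)+
    then have "mval (a i) i \<le> mval (a k) k" "mval (b j) j \<le> mval (b l) l"
      "mval (a i) i < mval (a k) k \<or> mval (b j) j < mval (b l) l"
      using i(3)[of k] j(3)[of l] False that by (cases "k = i"; cases "l = j"; force)+
    then have "g < mval (a k) k + mval (b l) l"
      unfolding g_def by (auto intro: add_less_le_mono add_le_less_mono)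
    then show ?thesis using mval_mult[of "a k" "b l" k l] False a(1) b(1) by simp
  qed
  have c_other: "c k = \<zero> \<or> g < mval (c k) k" if "k \<noteq> i + j" for k
    unfolding c_def
    using mval_finsum_greater[of "{..k}" "\<lambda>i. a i \<otimes> b (k - i)" g k] abA other that
    by (metis (no_types, lifting) add_diff_inverse_nat atMost_iff finite_atMost not_less)
  have c_main: "c (i + j) \<noteq> \<zero>" "mval (c (i + j)) (i + j) = g"
  proof -
    let ?f = "\<lambda>l. a l \<otimes> b (i + j - l)"
    \<comment> \<open>Within the coefficient of degree \<open>i + j\<close> the product of the two
      minimal terms is strictly dominant, so it cannot cancel and determines the value.\<close>
    have "c (i + j) = (\<Oplus>l\<in>insert i ({..i + j} - {i}). ?f l)"
      unfolding c_def by (rule finsum_cong') (use abA base_in_carrier in auto)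
    also have "\<dots> = ?f i \<oplus> (\<Oplus>l\<in>{..i + j} - {i}. ?f l)"
      using abA base_in_carrier by (intro finsum_insert) auto
    finally have eq: "c (i + j) = a i \<otimes> b j \<oplus> (\<Oplus>l\<in>{..i + j} - {i}. ?f l)" by simp
    have "?f l = \<zero> \<or> g < mval (?f l) (i + j)" if "l \<in> {..i + j} - {i}" for l
      using other[of l "i + j - l"] that by auto
    then have rest: "(\<Oplus>l\<in>{..i + j} - {i}. ?f l) \<in> A"
      "(\<Oplus>l\<in>{..i + j} - {i}. ?f l) = \<zero> \<or> g < mval (\<Oplus>l\<in>{..i + j} - {i}. ?f l) (i + j)"
      using mval_finsum_greater[of "{..i + j} - {i}" ?f g "i + j"] abA by blast+
    have main: "a i \<otimes> b j \<in> A - {\<zero>}" "mval (a i \<otimes> b j) (i + j) = g"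
      using base_mult_nonzero[of "a i" "b j"] mval_mult[of "a i" "b j" i j] a(1) b(1) i(2) j(2)
      by (auto simp: g_def)
    show "c (i + j) \<noteq> \<zero>" "mval (c (i + j)) (i + j) = g"
      using mval_add_eq[OF main(1) rest(1)] rest(2) main(2) eq by auto
  qed
  have c_eq: "c k = (if k = q then \<one> else if k = 0 then \<ominus> t else \<zero>)" for k
    unfolding c_def by (rule prod)
  have ends: "c q \<noteq> \<zero>" "c 0 \<noteq> \<zero>" "mval (c q) q = v (t [^] q)" "mval (c 0) 0 = v (t [^] q)"
    using mval_minus(1)[OF t_base] mval_minus(2)[OF t_base, of 0] t_base base_in_carrier[OF t_in] q_pos base_pow[OF t_in, of q] base_in_carrier
    by (auto simp: c_eq mval_def)
  \<comment> \<open>Only the two end coefficients of \<open>X^q - t\<close> are nonzero. One of them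
    sits at \<open>i + j\<close> and has value \<open>g\<close>; the other would have to exceed
    \<open>g\<close>, yet both have value \<open>v (t^q)\<close>.\<close>
  have "i + j = 0 \<or> i + j = q"
    using c_main(1) by (auto simp: c_eq split: if_splits)
  then have "g = v (t [^] q)" using c_main(2) ends by auto
  moreover have "g < v (t [^] q)"
    using \<open>i + j = 0 \<or> i + j = q\<close> c_other[of 0] c_other[of q] ends q_pos by auto
  ultimately show False by simp
qed

text \<open>The minimal polynomial divides \<open>X^q - t\<close>. If its degree were not
  \<open>q\<close>, it and its cofactor would both have degree below \<open>q\<close>, the situation
  excluded by \<open>no_proper_factorization\<close>.\<close>

lemma degree_Irr_eq: "degree (Irr A u) = q"
proof (rule ccontr)
  assume ne: "degree (Irr A u) \<noteq> q"
  note irr = IrrE(1)[OF base u_closed algebraic_u]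
  have inA: "set p \<subseteq> A" if "p \<in> carrier (A[X])" for p
    using that polynomial_incl by (simp add: univ_poly_carrier[symmetric])
  have inK: "set p \<subseteq> carrier K" if "p \<in> carrier (A[X])" for p
    using inA[OF that] base_in_carrier by blast
  have coeffA: "coeff p i \<in> A" if "p \<in> carrier (A[X])" for p i
    using inA[OF that] by (induction p) (auto simp: base_closed(1))
  have bin: "binom_poly q t \<in> carrier (A[X])" "binom_poly q t \<noteq> []"
    using binom_poly_closed[OF base_subring t_in] by (auto simp: binom_poly_def)
  obtain h where h: "h \<in> carrier (A[X])" "binom_poly q t = poly_mult (Irr A u) h"
    using Irr_dvd[OF bin(1) eval_binom_u] .
  have nz: "Irr A u \<noteq> []" "h \<noteq> []"
    using h bin(2) poly_mult_zero(2)[OF inK[OF irr]] by auto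
  then have deg: "degree (Irr A u) + degree h = q"
    using poly_mult_degree_eq[OF base_subring, of "Irr A u" h] irr h
      length_binom_poly[OF q_pos, of t]
    by (simp add: univ_poly_carrier)
  \<comment> \<open>Rules out a constant minimal polynomial and thereby a cofactor of degree
    \<open>q\<close>.\<close>
  have "degree (Irr A u) \<noteq> 0"
    using pirreducible_degree[OF base irr IrrE(2)[OF base u_closed algebraic_u]] by simp
  with deg ne have lt: "degree (Irr A u) < q" "degree h < q" by linarith+
  have lead: "coeff p (degree p) \<noteq> \<zero>" if "p \<in> carrier (A[X])" "p \<noteq> []" for p
    using that lead_coeff_simp[OF that(2)] by (auto simp: univ_poly_carrier[symmetric] polynomial_def simp del: lead_coeff_simp)
  show False
  proof (rule no_proper_factorization[of "coeff (Irr A u)" _ "coeff h"])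
    show "(\<Oplus>i\<in>{..k}. coeff (Irr A u) i \<otimes> coeff h (k - i))
        = (if k = q then \<one> else if k = 0 then \<ominus> t else \<zero>)" for k
      using poly_mult_coeff[OF inK[OF irr] inK[OF h(1)]] coeff_binom_poly[OF q_pos, of t k] h(2)
      by metis
    show "coeff (Irr A u) i = \<zero>" "coeff h i = \<zero>" if "i \<ge> q" for i
      using that lt by (auto intro!: coeff_degree)
  qed (use coeffA irr h lead nz in auto)
qed

end

section \<open>Norms and one-units\<close>

locale valued_kummer_extension = valued_radical_extension K A q t u v + kummer_extension K A q t u \<zeta>
  for K :: "('a, 'b) ring_scheme" (structure) and A q t u and v :: "'a \<Rightarrow> 'g::linordered_ab_group_add" and \<zeta>
begin

text \<open>The exponent \<open>i\<close> is not bounded by \<open>q\<close>, so that a product of monomials is again a monomial.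
  Reduction to \<open>i < q\<close> is needed only to recognize the elements of the base field.\<close>

inductive_set higher :: "'g \<Rightarrow> 'a set" for g where
  zero: "\<zero> \<in> higher g"
| add: "\<lbrakk>x \<in> higher g; c \<in> A - {\<zero>}; g < mval c i\<rbrakk> \<Longrightarrow> x \<oplus> c \<otimes> u [^] (i::nat) \<in> higher g"

section \<open>The filtration of the extension by sums of monomials\<close>

lemma monom_closed: "c \<in> A - {\<zero>} \<Longrightarrow> c \<otimes> u [^] (i::nat) \<in> carrier K"
  using base_in_carrier u_closed by simp

lemma higher_closed: "x \<in> higher g \<Longrightarrow> x \<in> carrier K"
  by (induction rule: higher.induct) (auto simp: monom_closed)

lemma higher_monom: "\<lbrakk>c \<in> A - {\<zero>}; g < mval c i\<rbrakk> \<Longrightarrow> c \<otimes> u [^] (i::nat) \<in> higher g"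
  using higher.add[OF higher.zero] monom_closed by fastforce

lemma higher_add: "\<lbrakk>y \<in> higher g; x \<in> higher g\<rbrakk> \<Longrightarrow> x \<oplus> y \<in> higher g"
proof (induction rule: higher.induct)
  case zero
  then show ?case by (simp add: higher_closed)
next
  case (add y c i)
  then show ?case
    using higher.add[of "x \<oplus> y" g c i] higher_closed monom_closed by (simp add: a_assoc)
qed

lemma higher_monom_mult:
  assumes "x \<in> higher g" "c \<in> A - {\<zero>}"
  shows "c \<otimes> u [^] (j::nat) \<otimes> x \<in> higher (mval c j + g)"
  using assms(1)
proof (induction rule: higher.induct)
  case zero
  then show ?case using monom_closed[OF assms(2)] by (simp add: higher.zero)
next
  case (add x d i)
  have "c \<otimes> u [^] j \<otimes> (d \<otimes> u [^] i) = (c \<otimes> d) \<otimes> u [^] (j + i)"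
    using assms(2) add.hyps(2) base_in_carrier u_closed by (simp add: nat_pow_mult[symmetric] m_ac)
  moreover have "mval c j + g < mval (c \<otimes> d) (j + i)"
    using mval_mult[OF assms(2) add.hyps(2)] add.hyps(3) by simp
  ultimately show ?case
    using higher.add[OF add.IH base_mult_nonzero[OF assms(2) add.hyps(2)]]
      higher_closed[OF add.hyps(1)] monom_closed assms(2) add.hyps(2)
    by (simp add: r_distr)
qed

lemma higher_mono: "\<lbrakk>x \<in> higher g; g' \<le> g\<rbrakk> \<Longrightarrow> x \<in> higher g'"
proof (induction rule: higher.induct)
  case (add x c i)
  then have "g' < mval c i" by simp
  then show ?case using add higher.add by blast
qed (rule higher.zero)

text \<open>Built up along the monomials of \<open>y\<close>: each has positive \<open>mval\<close>,
  and multiplication by it raises the level of \<open>x\<close> by that amount.\<close>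

lemma higher_0_mult: "\<lbrakk>y \<in> higher 0; x \<in> higher 0\<rbrakk> \<Longrightarrow> x \<otimes> y \<in> higher 0"
proof (induction rule: higher.induct)
  case zero
  then show ?case using higher_closed higher.zero by simp
next
  case (add y c i)
  have "c \<otimes> u [^] i \<otimes> x \<in> higher 0"
    using higher_monom_mult[OF add.prems add.hyps(2), of i] higher_mono[of _ "mval c i + 0" 0] add.hyps(3)
    by simp
  then show ?case
    using higher_add[OF _ add.IH[OF add.prems], of "c \<otimes> u [^] i \<otimes> x"]
      higher_closed[OF add.hyps(1)] higher_closed[OF add.prems] monom_closed[OF add.hyps(2)]
    by (metis higher_add m_comm r_distr add.IH add.prems)
qed

text \<open>A conjugation changes a monomial only by a power of \<open>\<zeta>\<close>, which has
  finite order and hence value zero.\<close>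

lemma higher_conj_map:
  assumes "x \<in> higher g"
  shows "conj_map n x \<in> higher g"
  using assms
proof (induction rule: higher.induct)
  interpret h: ring_hom_cring K K "conj_map n" by (rule conj_map_ring_hom_cring)
  case zero
  then show ?case by (simp add: higher.zero)
next
  interpret h: ring_hom_cring K K "conj_map n" by (rule conj_map_ring_hom_cring)
  case (add x c i)
  define e where "e = (\<zeta> [^] n) [^] i"
  have e: "e \<in> A - {\<zero>}" "e [^] q = \<one>"
    using base_pow[OF zeta_in] base_pow zeta_nonzero zeta_closed zeta_pow_pow[of "n * i"]
    by (simp_all add: e_def nat_pow_pow)
  have "conj_map n (c \<otimes> u [^] i) = (c \<otimes> e) \<otimes> u [^] i"
    using add.hyps(2) base_in_carrier u_closed zeta_closed conj_map_base[of c n]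
    by (simp add: h.ring.hom_nat_pow conj_map_u nat_pow_distrib m_assoc e_def)
  moreover have "g < mval (c \<otimes> e) i"
    using mval_mult[OF add.hyps(2) e(1), of i 0] e v_one add.hyps(3) by (simp add: mval_def)
  ultimately show ?case
    using higher.add[OF add.IH base_mult_nonzero[OF add.hyps(2) e(1)]]
      higher_closed[OF add.hyps(1)] monom_closed[OF add.hyps(2)] by simp
qed

lemma field_norm_one_plus_higher:
  assumes "m \<in> higher 0"
  obtains m' where "m' \<in> higher 0" "field_norm K F (\<one> \<oplus> m) = \<one> \<oplus> m'"
proof -
  have mult: "x \<otimes> y \<in> (\<oplus>) \<one> ` higher 0" if xy: "x \<in> (\<oplus>) \<one> ` higher 0" "y \<in> (\<oplus>) \<one> ` higher 0" for x y
  proof -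
    obtain a b where ab: "a \<in> higher 0" "b \<in> higher 0" "x = \<one> \<oplus> a" "y = \<one> \<oplus> b"
      using xy by blast
    have "a \<in> carrier K" "b \<in> carrier K" using ab higher_closed by auto
    then have "x \<otimes> y = \<one> \<oplus> (a \<oplus> b \<oplus> a \<otimes> b)"
      unfolding ab(3,4) by algebra
    moreover have "a \<oplus> b \<oplus> a \<otimes> b \<in> higher 0"
      using ab higher_add higher_0_mult by blast
    ultimately show ?thesis by blast
  qed
  have one: "\<one> \<in> (\<oplus>) \<one> ` higher 0"
    using higher.zero by (intro image_eqI[of _ _ \<zero>]) auto
  have sub: "x \<in> carrier K" if "x \<in> (\<oplus>) \<one> ` higher 0" for x
    using that higher_closed by auto
  have factor: "s (\<one> \<oplus> m) \<in> (\<oplus>) \<one> ` higher 0" if s: "s \<in> range conj_map" for s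
  proof -
    obtain n where n: "s = conj_map n" using s by blast
    have "s (\<one> \<oplus> m) = \<one> \<oplus> conj_map n m"
      using ring_hom_add[OF conj_map_hom, of \<one> m n] ring_hom_one[OF conj_map_hom]
        higher_closed[OF assms] n by simp
    then show ?thesis using higher_conj_map[OF assms] by blast
  qed
  \<comment> \<open>Stated for subsets of the Galois group to allow induction on a finite
    set.\<close>
  have "(\<Otimes>s\<in>S. s (\<one> \<oplus> m)) \<in> (\<oplus>) \<one> ` higher 0" if "finite S" "S \<subseteq> range conj_map" for S
    using that
  proof (induction S)
    case (insert s S)
    then have "(\<Otimes>s\<in>insert s S. s (\<one> \<oplus> m)) = s (\<one> \<oplus> m) \<otimes> (\<Otimes>s\<in>S. s (\<one> \<oplus> m))"
      using factor sub by (intro finprod_insert) auto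
    then show ?case using insert mult factor by auto
  qed (use one in simp)
  from this[OF finite_range_conj_map] show thesis
    using that unfolding field_norm_eq by blast
qed

section \<open>From the filtration back to the valuation of the base field\<close>

lemma finsum_add_term:
  assumes a: "\<And>i. a i \<in> A" and c: "c \<in> A" and r: "r < q"
  shows "(\<Oplus>i\<in>{..<q}. (a i \<oplus> (if i = r then c else \<zero>)) \<otimes> u [^] i)
    = (\<Oplus>i\<in>{..<q}. a i \<otimes> u [^] i) \<oplus> c \<otimes> u [^] r"
proof -
  have cl: "a i \<in> carrier K" "c \<in> carrier K" "u [^] i \<in> carrier K" for i :: nat
    using a c base_in_carrier u_closed by auto
  have "(\<Oplus>i\<in>{..<q}. (a i \<oplus> (if i = r then c else \<zero>)) \<otimes> u [^] i)
      = (\<Oplus>i\<in>{..<q}. a i \<otimes> u [^] i \<oplus> (if r = i then c \<otimes> u [^] i else \<zero>))"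
    by (rule finsum_cong') (use cl in \<open>auto simp: l_distr\<close>)
  also have "\<dots> = (\<Oplus>i\<in>{..<q}. a i \<otimes> u [^] i) \<oplus> (\<Oplus>i\<in>{..<q}. if r = i then c \<otimes> u [^] i else \<zero>)"
    by (rule finsum_addf) (use cl in auto)
  also have "(\<Oplus>i\<in>{..<q}. if r = i then c \<otimes> u [^] i else \<zero>) = c \<otimes> u [^] r"
    by (rule finsum_singleton) (use cl r in auto)
  finally show ?thesis .
qed

text \<open>Monomials with large exponents are brought below \<open>q\<close> by
  \<open>u^q = t\<close>, which moves powers of \<open>t\<close> into the coefficient and leaves
  \<open>mval\<close> unchanged. Collecting terms of equal exponent keeps the bound, by the
  ultrametric inequality.\<close>

lemma higher_representation:
  assumes "x \<in> higher g"
  shows "\<exists>a. (\<forall>i. a i \<in> A) \<and> x = (\<Oplus>i\<in>{..<q}. a i \<otimes> u [^] i)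
    \<and> (\<forall>i. a i = \<zero> \<or> g < mval (a i) i)"
  using assms
proof (induction rule: higher.induct)
  case zero
  have "(\<Oplus>i\<in>{..<q}. \<zero> \<otimes> u [^] i) = (\<Oplus>i\<in>{..<q}. \<zero>)"
    using u_closed by (intro finsum_cong') auto
  then show ?case
    using base_closed(1) by (intro exI[of _ "\<lambda>_. \<zero>"]) simp
next
  case (add x c i)
  then obtain a where a: "\<And>i. a i \<in> A" "x = (\<Oplus>i\<in>{..<q}. a i \<otimes> u [^] i)"
    "\<And>i. a i = \<zero> \<or> g < mval (a i) i" by blast
  \<comment> \<open>Division with remainder of the exponent: \<open>c u^i\<close> equals
    \<open>d u^r\<close>.\<close>
  define r where "r = i mod q"
  define d where "d = c \<otimes> t [^] (i div q)"
  have d: "d \<in> A - {\<zero>}"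
    unfolding d_def by (intro base_mult_nonzero add.hyps base_pow_nonzero t_base)
  have i: "i = q * (i div q) + r" by (simp add: r_def)
  have "u [^] i = u [^] (q * (i div q)) \<otimes> u [^] r"
    using u_closed i by (simp add: nat_pow_mult)
  also have "u [^] (q * (i div q)) = t [^] (i div q)"
    using nat_pow_pow[OF u_closed, of q "i div q"] u_pow by simp
  finally have "c \<otimes> u [^] i = d \<otimes> u [^] r"
    using add.hyps(2) base_in_carrier t_in u_closed by (simp add: d_def m_assoc)
  then have eq: "x \<oplus> c \<otimes> u [^] i = (\<Oplus>i\<in>{..<q}. (a i \<oplus> (if i = r then d else \<zero>)) \<otimes> u [^] i)"
    using finsum_add_term[OF a(1), of d r] d q_pos a(2) by (simp add: r_def)
  have "mval d r = mval c i"
  proof -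
    have "mval d r = v (c [^] q) + v ((t [^] (i div q)) [^] q) + v (t [^] r)"
      using mval_eq[OF d, of r] v_pow_mult[OF add.hyps(2) base_pow_nonzero[OF t_base], of "i div q" q]
      by (simp add: d_def)
    also have "\<dots> = v (c [^] q) + v (t [^] (q * (i div q) + r))"
      using v_pow_add[OF t_base] nat_pow_pow[OF base_in_carrier[OF t_in]] by (simp add: mult.commute add.assoc)
    finally show ?thesis using mval_eq[OF add.hyps(2), of i] i by simp
  qed
  then have "a i \<oplus> (if i = r then d else \<zero>) = \<zero> \<or> g < mval (a i \<oplus> (if i = r then d else \<zero>)) i" for i
    using mval_add_greater[of "a i" "if i = r then d else \<zero>" g i] a d base_closed(1) add.hyps(3)
    by auto
  moreover have "a i \<oplus> (if i = r then d else \<zero>) \<in> A" for i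
    using a d base_closed by auto
  ultimately show ?case
    using eq by (intro exI[of _ "\<lambda>i. a i \<oplus> (if i = r then d else \<zero>)"]) simp
qed

text \<open>Coordinates are unique, so an element of \<open>A\<close> is its own coordinate at
  \<open>u^0\<close>, and the bound on that coordinate is a bound on its value.\<close>

lemma higher_base:
  assumes "x \<in> higher g" "x \<in> A"
  shows "x = \<zero> \<or> g < mval x 0"
proof -
  obtain a where a: "\<And>i. a i \<in> A" "x = (\<Oplus>i\<in>{..<q}. a i \<otimes> u [^] i)"
    "\<And>i. a i = \<zero> \<or> g < mval (a i) i"
    using higher_representation[OF assms(1)] by blast
  have xK: "x \<in> carrier K" "\<ominus> x \<in> A" using assms(2) base_in_carrier base_closed(3) by auto
  \<comment> \<open>Subtracting \<open>x\<close> at exponent zero produces a vanishing sum, to which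
    linear independence applies.\<close>
  have "(\<Oplus>i\<in>{..<q}. (a i \<oplus> (if i = 0 then \<ominus> x else \<zero>)) \<otimes> u [^] i) = x \<oplus> \<ominus> x \<otimes> u [^] (0::nat)"
    using finsum_add_term[OF a(1) xK(2) q_pos] a(2) by simp
  also have "\<dots> = \<zero>" using xK by (simp add: r_neg)
  finally have "a 0 \<oplus> (if (0::nat) = 0 then \<ominus> x else \<zero>) = \<zero>"
    using powers_independent[of q "\<lambda>i. a i \<oplus> (if i = 0 then \<ominus> x else \<zero>)" 0]
      a(1) xK base_closed degree_Irr q_pos by auto
  then have "a 0 = x"
    using r_right_minus_eq[OF base_in_carrier[OF a(1)] xK(1), of 0] by (simp add: minus_eq)
  then show ?thesis using a(3)[of 0] by simp
qed

text \<open>Exactly one monomial of \<open>x\<close> has least value; dividing by it sends all the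
  others to positive values.\<close>

lemma leading_monomial:
  assumes x: "x \<in> carrier K" "x \<noteq> \<zero>"
  obtains c i m where "c \<in> A - {\<zero>}" "i < q" "m \<in> higher 0" "x = c \<otimes> u [^] i \<otimes> (\<one> \<oplus> m)"
proof -
  obtain a where ran: "range a \<subseteq> A" and x_eq: "x = (\<Oplus>i\<in>{..<q}. a i \<otimes> u [^] i)"
    by (rule powers_span[OF x(1), unfolded degree_Irr])
  have a: "a i \<in> A" for i using ran by blast
  have term_closed: "a i \<otimes> u [^] i \<in> carrier K" for i
    using a base_in_carrier u_closed by simp
  have "\<exists>j<q. a j \<noteq> \<zero>"
  proof (rule ccontr)
    assume "\<not> ?thesis"
    then have "x = (\<Oplus>i\<in>{..<q}. \<zero>)"
      unfolding x_eq using u_closed by (intro finsum_cong') auto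
    with x(2) show False by simp
  qed
  then obtain i where i: "i < q" "a i \<noteq> \<zero>"
    and min: "\<And>k. \<lbrakk>k < q; k \<noteq> i; a k \<noteq> \<zero>\<rbrakk> \<Longrightarrow> mval (a i) i < mval (a k) k"
    using minimal_term[of a] a by blast
  have ai: "a i \<in> A - {\<zero>}" using a i by simp
  define r where "r = (\<Oplus>k\<in>{..<q} - {i}. a k \<otimes> u [^] k)"
  have "(\<Oplus>k\<in>S. a k \<otimes> u [^] k) \<in> higher (mval (a i) i)" if "finite S" "S \<subseteq> {..<q} - {i}" for S
    using that
  proof (induction S)
    case empty
    show ?case by (simp add: higher.zero)
  next
    case (insert k S)
    then have eq: "(\<Oplus>k\<in>insert k S. a k \<otimes> u [^] k) = a k \<otimes> u [^] k \<oplus> (\<Oplus>k\<in>S. a k \<otimes> u [^] k)"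
      using term_closed by (intro finsum_insert) auto
    have "a k \<otimes> u [^] k \<in> higher (mval (a i) i)"
    proof (cases "a k = \<zero>")
      case True
      then show ?thesis using u_closed by (simp add: higher.zero)
    next
      case False
      then show ?thesis using higher_monom[of "a k"] min[of k] insert.prems a by auto
    qed
    then show ?case unfolding eq using insert higher_add by auto
  qed
  then have r: "r \<in> higher (mval (a i) i)" unfolding r_def by simp
  have "x = (\<Oplus>k\<in>insert i ({..<q} - {i}). a k \<otimes> u [^] k)"
    unfolding x_eq using i(1) term_closed by (intro finsum_cong') auto
  also have "\<dots> = a i \<otimes> u [^] i \<oplus> r"
    unfolding r_def using term_closed by (intro finsum_insert) auto
  finally have x_split: "x = a i \<otimes> u [^] i \<oplus> r" .
  \<comment> \<open>The inverse of \<open>a_i u^i\<close> is again a monomial, namely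
    \<open>d u^(i (q - 1))\<close>, because \<open>u^(i (q - 1)) u^i = t^i\<close>.\<close>
  define d where "d = inv (a i \<otimes> t [^] i)"
  have prod: "a i \<otimes> t [^] i \<in> A - {\<zero>}"
    by (rule base_mult_nonzero[OF ai base_pow_nonzero[OF t_base]])
  have d: "d \<in> A - {\<zero>}" "a i \<otimes> t [^] i \<otimes> d = \<one>"
    unfolding d_def using subfield_m_inv[OF base prod] by auto
  have exponent: "i * (q - 1) + i = q * i"
    using q_pos by (auto simp: algebra_simps)
  have powers: "u [^] (i * (q - 1)) \<otimes> u [^] i = t [^] i"
    using nat_pow_mult[OF u_closed, of "i * (q - 1)" i] nat_pow_pow[OF u_closed, of q i] u_pow
    unfolding exponent by simp
  define m where "m = d \<otimes> u [^] (i * (q - 1)) \<otimes> r"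
  \<comment> \<open>A monomial and its inverse have opposite \<open>mval\<close>, so the level of
    \<open>r\<close> is shifted exactly to zero.\<close>
  have "mval d (i * (q - 1)) + mval (a i) i = v ((d \<otimes> a i) [^] q) + v (t [^] (q * i))"
    using mval_mult[OF d(1) ai, of "i * (q - 1)" i] mval_eq[OF base_mult_nonzero[OF d(1) ai]]
    unfolding exponent by simp
  also have "\<dots> = v ((d \<otimes> a i) [^] q) + v ((t [^] i) [^] q)"
    using nat_pow_pow[OF base_in_carrier[OF t_in], of i q] by (simp add: mult.commute)
  also have "\<dots> = v (((d \<otimes> a i) \<otimes> t [^] i) [^] q)"
    using v_pow_mult[OF base_mult_nonzero[OF d(1) ai] base_pow_nonzero[OF t_base]] by simp
  also have "(d \<otimes> a i) \<otimes> t [^] i = \<one>"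
    using d ai base_in_carrier t_in by (simp add: m_ac)
  finally have m: "m \<in> higher 0"
    using higher_monom_mult[OF r d(1), of "i * (q - 1)"] v_one by (simp add: m_def)
  have rK: "r \<in> carrier K" by (rule higher_closed[OF r])
  have "a i \<otimes> u [^] i \<otimes> m = (a i \<otimes> (u [^] (i * (q - 1)) \<otimes> u [^] i) \<otimes> d) \<otimes> r"
    unfolding m_def using d(1) ai base_in_carrier u_closed rK by (simp add: m_ac)
  also have "\<dots> = r"
    unfolding powers using d rK by simp
  finally have "x = a i \<otimes> u [^] i \<otimes> (\<one> \<oplus> m)"
    using x_split term_closed[of i] higher_closed[OF m] by (simp add: r_distr)
  with ai i m that show thesis by blast
qed

lemma field_norm_unit:
  assumes x: "x \<in> field_norm K F ` carrier K" "x \<in> A - {\<zero>}" "v x = 0"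
  shows "\<exists>c\<in>A - {\<zero>}. \<exists>f\<in>valuation_ideal F v. v c = 0 \<and> x = c [^] q \<otimes> (\<one> \<oplus> f)"
proof -
  obtain y where y: "y \<in> carrier K" "x = field_norm K F y" using x(1) by blast
  have "field_norm K F \<zero> = \<zero>"
    using field_norm_base[OF base_closed(1)] q_pos by (simp add: nat_pow_zero)
  with y x(2) have "y \<noteq> \<zero>" by auto
  then obtain c i m where c: "c \<in> A - {\<zero>}" and i: "i < q" and m: "m \<in> higher 0"
    and y_eq: "y = c \<otimes> u [^] i \<otimes> (\<one> \<oplus> m)"
    using leading_monomial[OF y(1)] by metis
  obtain f where f: "f \<in> higher 0" "field_norm K F (\<one> \<oplus> m) = \<one> \<oplus> f"
    using field_norm_one_plus_higher[OF m] .
  define n where "n = field_norm K F u"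
  define b where "b = c [^] q \<otimes> n [^] i"
  have "n [^] q \<noteq> \<zero>"
    using field_norm_u_pow base_pow_nonzero[OF t_base] by (simp add: n_def)
  then have n: "n \<in> A - {\<zero>}"
    using field_norm_u_in_base q_pos by (auto simp: n_def nat_pow_zero)
  have b: "b \<in> A - {\<zero>}"
    unfolding b_def by (intro base_mult_nonzero base_pow_nonzero c n)
  have x_eq: "x = b \<otimes> (\<one> \<oplus> f)"
    using y(2) y_eq c u_closed base_in_carrier higher_closed[OF m] f(2)
    by (simp add: field_norm_mult field_norm_base field_norm_pow b_def n_def)
  have fK: "f \<in> carrier K" by (rule higher_closed[OF f(1)])
  \<comment> \<open>Both \<open>x\<close> and \<open>b\<close> lie in \<open>A\<close>, hence so
    does their quotient; only then can \<open>f\<close> be measured by \<open>v\<close>.\<close>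
  have "\<one> \<oplus> f \<in> A"
    using subfield_m_inv_simprule[OF base b] x_eq x(2) fK by simp
  then have "\<ominus> \<one> \<oplus> (\<one> \<oplus> f) \<in> A"
    using base_closed by simp
  then have fA: "f \<in> A"
    using fK by (simp add: a_assoc[symmetric] l_neg)
  have f_pos: "f = \<zero> \<or> 0 < v f"
    using higher_base[OF f(1) fA] fA v_one base_in_carrier
      valued_field.v_pow_pos_iff[OF valued, of f q] q_pos base_in_carrier[OF base_pow[OF fA]]
    by (auto simp: mval_def nat_pow_def)
  then have one_f: "\<one> \<oplus> f \<in> A - {\<zero>}" "v (\<one> \<oplus> f) = 0"
    using v_add_eq[of \<one> f] fA base_closed v_one by auto
  have "v n = v t"
    using v_pow_inj[OF n t_base, of q] field_norm_u_pow q_pos by (simp add: n_def)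
  \<comment> \<open>The norm of \<open>u\<close> has the value of \<open>t\<close>, so
    \<open>c^q N(u)^i\<close> has the value of \<open>c^q t^i\<close>.\<close>
  then have "v b = mval c i"
    unfolding b_def mval_eq[OF c]
    using v_mult[of "c [^] q" "n [^] i"] base_pow_nonzero c n v_pow_cong[OF n t_base] by simp
  moreover have "v b = 0"
    using v_mult[of b "\<one> \<oplus> f"] b one_f x_eq x(3) by simp
  \<comment> \<open>Value zero is also that of the monomial with coefficient one and exponent zero,
    so \<open>separated\<close> compares \<open>i\<close> with \<open>0\<close>.\<close>
  ultimately have value_eq: "v (c [^] q \<otimes> t [^] i) = v (\<one> [^] q \<otimes> t [^] (0::nat))"
    by (simp add: mval_def v_one)
  then have "i = 0"
    using separated[OF c _ i q_pos, of \<one>] base_closed(2) by simp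
  then have "v (c [^] q) = v (\<one> [^] q)" "x = c [^] q \<otimes> (\<one> \<oplus> f)"
    using value_eq x_eq base_in_carrier c by (simp_all add: b_def)
  moreover from this(1) have "v c = 0"
    using v_pow_inj[OF c _ _ q_pos, of \<one>] base_closed(2) v_one by simp
  moreover have "f \<in> valuation_ideal F v"
    using fA f_pos by (simp add: valuation_ideal_def)
  ultimately show ?thesis using c by blast
qed

theorem residue_map_field_norm:
  "residue_map F v ` (field_norm K F ` carrier K) - {\<zero>\<^bsub>residue_field F v\<^esub>}
    = nth_powers (units_of (residue_field F v)) q"
proof (rule valued_field.residue_map_image_eq_nth_powers[OF valued q_pos])
  show "c [^]\<^bsub>F\<^esub> q \<in> field_norm K F ` carrier K" if "c \<in> carrier F" for c
    using that field_norm_base[of c] base_in_carrier by (auto simp: nat_pow_def image_iff intro!: bexI[of _ c])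
  show "\<exists>c\<in>carrier F - {\<zero>\<^bsub>F\<^esub>}. \<exists>f\<in>valuation_ideal F v. v c = 0 \<and> x = c [^]\<^bsub>F\<^esub> q \<otimes>\<^bsub>F\<^esub> (\<one>\<^bsub>F\<^esub> \<oplus>\<^bsub>F\<^esub> f)"
    if "x \<in> field_norm K F ` carrier K" "x \<in> carrier F - {\<zero>\<^bsub>F\<^esub>}" "v x = 0" for x
    using field_norm_unit[of x] that by (simp add: nat_pow_def)
qed

end

theorem theorem2p4:
  fixes F K :: "'a ring"
    and v :: "'a \<Rightarrow> 'g::linordered_ab_group_add"
    and q :: nat
    and t u :: 'a
  assumes "valued_field F v"
    and "equicharacteristic F v"
    and "Factorial_Ring.prime q"
    and "t \<in> carrier F - {\<zero>\<^bsub>F\<^esub>}"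
    and "inj_on (\<lambda>i::nat. nth_powers (value_group F v) q
            #>\<^bsub>value_group F v\<^esub> (v t [^]\<^bsub>value_group F v\<^esub> i)) {..<q}"
    and "field_extension K F"
    and "u \<in> carrier K" and "u [^]\<^bsub>K\<^esub> q = t"
    and "carrier K = generate_field K (insert u (carrier F))"
    and "ring_characteristic F \<noteq> q"
    and "primitive_roots K q \<noteq> {}" and "primitive_roots K q \<subseteq> carrier F"
  shows "cyclic_extension K F
    \<and> ring.dimension K q (carrier F) (carrier K)
    \<and> carrier F \<noteq> carrier K
    \<and> residue_map F v ` (field_norm K F ` carrier K) - {\<zero>\<^bsub>residue_field F v\<^esub>}
        = nth_powers (units_of (residue_field F v)) q"
proof -
  define A where "A = carrier F"
  have K: "field K" and A: "subfield A K" and F: "F = K\<lparr>carrier := A\<rparr>"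
    using assms(6) by (auto simp: field_extension_def A_def)
  obtain \<zeta> where zeta: "\<zeta> \<in> A" "\<zeta> [^]\<^bsub>K\<^esub> q = \<one>\<^bsub>K\<^esub>"
    "\<And>m. \<lbrakk>0 < m; m < q\<rbrakk> \<Longrightarrow> \<zeta> [^]\<^bsub>K\<^esub> (m::nat) \<noteq> \<one>\<^bsub>K\<^esub>"
    using assms(11,12) unfolding primitive_roots_def A_def by blast
  interpret K: field K by (rule K)
  interpret R: radical_extension K A q t u
  proof (intro radical_extension.intro radical_extension_axioms.intro)
    have "\<zero>\<^bsub>F\<^esub> = \<zero>\<^bsub>K\<^esub>" by (simp add: F)
    then show "t \<in> A" "t \<noteq> \<zero>\<^bsub>K\<^esub>" using assms(4) by (auto simp: A_def)
  qed (fact K A assms(3,7,8) assms(9)[folded A_def])+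
  interpret VR: valued_radical_extension K A q t u v
  proof (intro valued_radical_extension.intro valued_radical_extension_axioms.intro R.radical_extension_axioms)
    show "valued_field (K\<lparr>carrier := A\<rparr>) v" using assms(1) F by simp
    show "i = j" if "c \<in> A - {\<zero>\<^bsub>K\<^esub>}" "d \<in> A - {\<zero>\<^bsub>K\<^esub>}" "i < q" "j < q"
      "v (c [^]\<^bsub>K\<^esub> q \<otimes>\<^bsub>K\<^esub> t [^]\<^bsub>K\<^esub> i) = v (d [^]\<^bsub>K\<^esub> q \<otimes>\<^bsub>K\<^esub> t [^]\<^bsub>K\<^esub> j)" for c d i j
      using valued_field.separated_if_cosets_distinct[OF assms(1,4,5), of c d i j] that
      by (simp add: F nat_pow_def)
  qed
  \<comment> \<open>The degree required by the Galois part is now available from the valuation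
    argument.\<close>
  interpret VK: valued_kummer_extension K A q t u v \<zeta>
    by (intro valued_kummer_extension.intro kummer_extension.intro kummer_extension_axioms.intro
        VR.valued_radical_extension_axioms R.radical_extension_axioms zeta VR.degree_Irr_eq)
  have "K.dimension q A (carrier K)"
    using R.dimension_degree VR.degree_Irr_eq by simp
  moreover have "A \<noteq> carrier K"
    using VK.base_proper assms(7) by metis
  ultimately show ?thesis
    unfolding F
    using VK.cyclic_extension_base VK.residue_map_field_norm by simp
qed

end
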